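(* Suppose that $f(z)=h(z)+\overline{g(z)}=\sum_{n=0}^{\infty}a_n z^n+\overline{\sum_{n=1}^{\infty}b_n z^n}$ is a sense-preserving harmonic mapping in $\mathbb{D}$ and $h\prec \varphi$, where $\varphi$ is analytic and univalent in $\mathbb{D}$. Then $$\sum_{n=1}^{\infty}(|a_n|+|b_n|)r^n\leq \operatorname{dist}(\varphi(0),\partial\varphi(\mathbb{D}))$$ for $|z|=r\leq r_u= 0.099064\cdots$, where $r_u$ is the root of the equation $$(1-r)^2-4r(1+\sqrt{1+r})=0$$ in the interval $(0,1)$.
   Context: $\mathbb{D}=\{z\in\mathbb{C}:|z|<1\}$. A harmonic mapping $f$ in $\mathbb{D}$ is a complex-valued function whose real and imaginary parts are harmonic; it is written $f=h+\overline{g}$ with $h,g$ analytic in $\mathbb{D}$ and $g(0)=0$, $h(z)=\sum_{n\ge 0}a_nz^n$, $g(z)=\sum_{n\ge 1}b_nz^n$. A locally univalent harmonic mapping $f=h+\overline{g}$ is sense-preserving if $|h'(z)|^2-|g'(z)|^2>0$ in $\mathbb{D}$ (equivalently, the dilatation $\omega=g'/h'$ is analytic and maps $\mathbb{D}$ into itself). For analytic $h,\varphi$ in $\mathbb{D}$ with $h(0)=\varphi(0)$, $h\prec\varphi$ ($h$ is subordinate to $\varphi$) means $h(z)=\varphi(w(z))$ for some analytic $w$ on $\mathbb{D}$ with $|w(z)|\le|z|$. $\operatorname{dist}(\varphi(0),\partial\varphi(\mathbb{D}))$ is the Euclidean distance from $\varphi(0)$ to the boundary of $\varphi(\mathbb{D})$.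 *)

theory Defs
  imports "HOL-Complex_Analysis.Complex_Analysis"
begin

text \<open>
  Real-valued harmonic functions: twice continuously differentiable with vanishing Laplacian.
  The plane is identified with \<open>\<real>\<^sup>2\<close> through \<open>z = x + \<i> y\<close>, so \<open>ux\<close>, \<open>uy\<close> are the first and
  \<open>uxx\<close>, \<open>uxy\<close>, \<open>uyx\<close>, \<open>uyy\<close> the second partial derivatives of \<open>u\<close>.
\<close>

definition harmonic_fun_on :: "(complex \<Rightarrow> real) \<Rightarrow> complex set \<Rightarrow> bool" where
  "harmonic_fun_on u S \<longleftrightarrow>
     (\<exists>ux uy uxx uxy uyx uyy :: complex \<Rightarrow> real.
        continuous_on S uxx \<and> continuous_on S uxy \<and> continuous_on S uyx \<and> continuous_on S uyy \<and>
        (\<forall>z\<in>S.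
           (u has_derivative (\<lambda>v. ux z * Re v + uy z * Im v)) (at z) \<and>
           (ux has_derivative (\<lambda>v. uxx z * Re v + uxy z * Im v)) (at z) \<and>
           (uy has_derivative (\<lambda>v. uyx z * Re v + uyy z * Im v)) (at z) \<and>
           uxx z + uyy z = 0))"

definition harmonic_mapping_on :: "(complex \<Rightarrow> complex) \<Rightarrow> complex set \<Rightarrow> bool" where
  "harmonic_mapping_on f S \<longleftrightarrow>
     harmonic_fun_on (\<lambda>z. Re (f z)) S \<and> harmonic_fun_on (\<lambda>z. Im (f z)) S"

definition canonical_decomposition ::
    "(complex \<Rightarrow> complex) \<Rightarrow> (complex \<Rightarrow> complex) \<Rightarrow> (complex \<Rightarrow> complex) \<Rightarrow> bool" where
  "canonical_decomposition f h g \<longleftrightarrow>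
     h holomorphic_on ball 0 1 \<and> g holomorphic_on ball 0 1 \<and> g 0 = 0 \<and>
     (\<forall>z\<in>ball 0 1. f z = h z + cnj (g z))"

definition locally_univalent_on :: "(complex \<Rightarrow> complex) \<Rightarrow> complex set \<Rightarrow> bool" where
  "locally_univalent_on f S \<longleftrightarrow>
     (\<forall>z\<in>S. \<exists>U. open U \<and> z \<in> U \<and> U \<subseteq> S \<and> inj_on f U)"

text \<open>
  The first and third conjuncts below are consequences of the other two (Cauchy--Riemann equations,
  inverse function theorem); they are kept so that the definition reads as in the literature.
\<close>

definition sense_preserving_harmonic ::
    "(complex \<Rightarrow> complex) \<Rightarrow> (complex \<Rightarrow> complex) \<Rightarrow> (complex \<Rightarrow> complex) \<Rightarrow> bool" where
  "sense_preserving_harmonic f h g \<longleftrightarrow>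
     harmonic_mapping_on f (ball 0 1) \<and>
     canonical_decomposition f h g \<and>
     locally_univalent_on f (ball 0 1) \<and>
     (\<forall>z\<in>ball 0 1. (cmod (deriv h z))\<^sup>2 - (cmod (deriv g z))\<^sup>2 > 0)"

definition subordinate :: "(complex \<Rightarrow> complex) \<Rightarrow> (complex \<Rightarrow> complex) \<Rightarrow> bool" where
  "subordinate h \<phi> \<longleftrightarrow>
     h holomorphic_on ball 0 1 \<and> \<phi> holomorphic_on ball 0 1 \<and> h 0 = \<phi> 0 \<and>
     (\<exists>w. w holomorphic_on ball 0 1 \<and>
          (\<forall>z\<in>ball 0 1. cmod (w z) \<le> cmod z \<and> h z = \<phi> (w z)))"

definition radius_root :: "real \<Rightarrow> bool" where
  "radius_root r \<longleftrightarrow> 0 < r \<and> r < 1 \<and> (1 - r)\<^sup>2 - 4 * r * (1 + sqrt (1 + r)) = 0"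

definition r_u :: real where
  "r_u = (THE r. radius_root r)"

end

theory Submission
  imports Defs
begin

text \<open>
  Let \<open>w\<^sub>0\<close> be a boundary point of \<open>\<phi>(\<D>)\<close> nearest to \<open>\<phi>(0)\<close> and \<open>d = |\<phi>(0) - w\<^sub>0|\<close>. De Branges' bound
  \<open>|a\<^sub>n| \<le> 4 n d\<close> is not needed: the sharp Koebe estimate for the nonvanishing function \<open>h - w\<^sub>0\<close> gives
  \<open>|F(z)| \<le> 4 / (1 - |z|\<^sup>2)\<close> for \<open>F = h' / (h - w\<^sub>0)\<close>. If \<open>c\<^sub>k\<close> are the coefficients of \<open>F\<close>, then
  \<open>\<Sum>\<^sub>n\<^sub>\<ge>\<^sub>1 |a\<^sub>n| r\<^sup>n \<le> d (exp (\<Sum>\<^sub>k |c\<^sub>k| r\<^sup>k\<^sup>+\<^sup>1 / (k + 1)) - 1)\<close>, and \<open>|c\<^sub>k| \<rho>\<^sup>k \<le> 2 (4 / (1 - \<rho>\<^sup>2) - |c\<^sub>0|)\<close> makes the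
  exponent less than \<open>ln (3/2)\<close> up to \<open>r = 0.0991 > r\<^sub>u\<close>. So the \<open>a\<close>-part is at most \<open>d / 2\<close>. By Bohr's
  argument for the multiplier \<open>g' / h'\<close>, the \<open>b\<close>-part is at most the \<open>a\<close>-part.

  The Koebe estimate follows from two area inequalities. An injective holomorphic \<open>k\<close> maps the disc of radius
  \<open>\<rho>\<close> onto a set of area at least \<open>\<pi> \<rho>\<^sup>2 |k'(0)|\<^sup>2\<close>. On the other hand, by Ahlfors and Beurling,
  \<open>|\<integral>\<^sub>K dA(w) / (w - z)| \<le> sqrt (\<pi> area K)\<close>, which bounds the area of a compact set omitted
  by \<open>1 / q\<close> when \<open>q(0) = 0\<close>.
\<close>

section \<open>Change of variables for injective holomorphic maps\<close>

text \<open>The change of variables theorem with Jacobian determinants is stated on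
  \<open>real^'n\<close>; this map and its inverse below carry sets and integrals of the complex
  plane there and back.\<close>

definition vec2_of_complex :: "complex \<Rightarrow> real^2" where
  "vec2_of_complex z = vector [Re z, Im z]"

definition complex_of_vec2 :: "real^2 \<Rightarrow> complex" where
  "complex_of_vec2 p = Complex (p $ 1) (p $ 2)"

lemma vec2_of_complex_nth [simp]:
  "vec2_of_complex z $ 1 = Re z" "vec2_of_complex z $ 2 = Im z"
  by (simp_all add: vec2_of_complex_def)

lemma complex_of_vec2_inverse [simp]:
  "complex_of_vec2 (vec2_of_complex z) = z" "vec2_of_complex (complex_of_vec2 p) = p"
  by (simp_all add: complex_of_vec2_def vec_eq_iff forall_2)

lemma linear_vec2_of_complex: "linear vec2_of_complex"
  by (rule linearI) (simp_all add: vec_eq_iff forall_2)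

lemma bounded_linear_vec2_of_complex: "bounded_linear vec2_of_complex"
  using linear_vec2_of_complex linear_conv_bounded_linear by blast

lemma bounded_linear_complex_of_vec2: "bounded_linear complex_of_vec2"
  unfolding linear_conv_bounded_linear[symmetric]
  by (rule linearI) (simp_all add: complex_of_vec2_def complex_eq_iff)

lemma inj_vec2_of_complex: "inj vec2_of_complex"
  by (metis complex_of_vec2_inverse(1) injI)

lemma complex_of_vec2_image_vec2_of_complex [simp]: "complex_of_vec2 ` vec2_of_complex ` S = S"
  by (force simp: image_image)

lemma continuous_on_vec2_of_complex [continuous_intros]:
  "continuous_on S f \<Longrightarrow> continuous_on S (\<lambda>x. vec2_of_complex (f x))"
  by (rule bounded_linear.continuous_on[OF bounded_linear_vec2_of_complex])

lemma continuous_on_complex_of_vec2 [continuous_intros]: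
  "continuous_on S f \<Longrightarrow> continuous_on S (\<lambda>x. complex_of_vec2 (f x))"
  by (rule bounded_linear.continuous_on[OF bounded_linear_complex_of_vec2])

text \<open>Both sides give a box the product of its side lengths, which characterises Lebesgue
  measure.\<close>

lemma lborel_vec2_eq_distr: "(lborel :: (real^2) measure) = distr lborel borel vec2_of_complex"
proof (rule lborel_eqI)
  fix l u :: "real^2"
  assume le: "\<And>b. b \<in> Basis \<Longrightarrow> l \<bullet> b \<le> u \<bullet> b"
  have le12: "l $ 1 \<le> u $ 1" "l $ 2 \<le> u $ 2"
    using le[of "axis 1 1"] le[of "axis 2 1"] by (auto simp: Basis_vec_def inner_axis)
  have meas: "vec2_of_complex \<in> borel_measurable lborel"
    using borel_measurable_continuous_onI[OF continuous_on_vec2_of_complex[OF continuous_on_id]]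
    by simp
  have vimage: "vec2_of_complex -` box l u = box (complex_of_vec2 l) (complex_of_vec2 u)"
    by (auto simp: mem_box Basis_vec_def inner_axis Basis_complex_def complex_of_vec2_def
        UNIV_2)
  have "emeasure (distr lborel borel vec2_of_complex) (box l u)
      = emeasure lborel (box (complex_of_vec2 l) (complex_of_vec2 u))"
    using meas by (subst emeasure_distr) (auto simp: vimage)
  also have "\<dots> = (\<Prod>b\<in>Basis. (complex_of_vec2 u - complex_of_vec2 l) \<bullet> b)"
    using le12 by (subst emeasure_lborel_box) (auto simp: Basis_complex_def complex_of_vec2_def)
  also have "(\<Prod>b\<in>Basis. (complex_of_vec2 u - complex_of_vec2 l) \<bullet> b) = (\<Prod>b\<in>Basis. (u - l) \<bullet> b)"
  proof -
    have B: "(Basis :: (real^2) set) = {axis 1 1, axis 2 1}"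
      by (auto simp: Basis_vec_def UNIV_2)
    have "axis 1 1 \<noteq> (axis 2 1 :: real^2)"
      by (simp add: axis_eq_axis)
    then have "(\<Prod>b\<in>Basis. (u - l) \<bullet> b) = ((u - l) \<bullet> axis 1 1) * ((u - l) \<bullet> axis 2 1)"
      unfolding B by simp
    then show ?thesis
      by (simp add: Basis_complex_def complex_of_vec2_def inner_axis)
  qed
  finally show "emeasure (distr lborel borel vec2_of_complex) (box l u) = (\<Prod>b\<in>Basis. (u - l) \<bullet> b)" .
qed simp

lemma set_integrable_compact:
  fixes f :: "'a::euclidean_space \<Rightarrow> 'b::{banach, second_countable_topology}"
  assumes "compact K" "continuous_on K f"
  shows "set_integrable lborel K f"
  using borel_integrable_compact[OF assms] by (simp add: set_integrable_def indicator_scaleR_eq_if)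

text \<open>The bridge from the Lebesgue integral on the complex plane to the gauge integral on
  \<open>real^2\<close> in which the change of variables is expressed. The values of
  \<open>f\<close> are transported too, since the integrand there is vector valued.\<close>

lemma set_integral_vec2:
  fixes f :: "complex \<Rightarrow> complex"
  assumes K: "compact K" and f: "continuous_on K f"
  shows "integral (vec2_of_complex ` K) (\<lambda>p. vec2_of_complex (f (complex_of_vec2 p)))
       = vec2_of_complex (LINT z:K|lborel. f z)"
    and "(\<lambda>p. vec2_of_complex (f (complex_of_vec2 p))) absolutely_integrable_on vec2_of_complex ` K"
proof -
  let ?K = "vec2_of_complex ` K" and ?f = "\<lambda>p. vec2_of_complex (f (complex_of_vec2 p))"
  have meas: "vec2_of_complex \<in> borel_measurable lborel"
    using borel_measurable_continuous_onI[OF continuous_on_vec2_of_complex[OF continuous_on_id]]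
    by simp
  have K': "compact ?K"
    by (intro compact_continuous_image continuous_intros K)
  have f': "continuous_on ?K ?f"
    by (intro continuous_intros continuous_on_compose2[OF f]) auto
  have int: "set_integrable lborel ?K ?f"
    by (rule set_integrable_compact[OF K' f'])
  show "?f absolutely_integrable_on ?K"
    using int unfolding set_integrable_def by (subst integrable_completion) auto
  have "integral ?K ?f = (LINT p:?K|lborel. ?f p)"
    using set_borel_integral_eq_integral(2)[OF int] by simp
  also have "\<dots> = (LINT p|distr lborel borel vec2_of_complex. indicator ?K p *\<^sub>R ?f p)"
    unfolding set_lebesgue_integral_def by (subst lborel_vec2_eq_distr) simp
  also have "\<dots> = (LINT z|lborel. indicator ?K (vec2_of_complex z) *\<^sub>R ?f (vec2_of_complex z))"
    using meas borel_measurable_continuous_on_indicator[OF borel_compact[OF K'] f']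
    by (subst integral_distr) auto
  also have "\<dots> = (LINT z|lborel. vec2_of_complex (indicator K z *\<^sub>R f z))"
    using inj_vec2_of_complex
    by (intro Bochner_Integration.integral_cong)
       (auto simp: inj_image_mem_iff indicator_def linear_0[OF linear_vec2_of_complex])
  also have "\<dots> = vec2_of_complex (LINT z|lborel. indicator K z *\<^sub>R f z)"
    using set_integrable_compact[OF K f] unfolding set_integrable_def
    by (rule integral_bounded_linear[OF bounded_linear_vec2_of_complex])
  finally show "integral ?K ?f = vec2_of_complex (LINT z:K|lborel. f z)"
    by (simp add: set_lebesgue_integral_def)
qed

lemma has_derivative_conj_vec2:
  assumes "(k has_field_derivative d) (at (complex_of_vec2 p) within K)"
  shows "((\<lambda>p. vec2_of_complex (k (complex_of_vec2 p))) has_derivative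
          (\<lambda>q. vec2_of_complex (d * complex_of_vec2 q))) (at p within vec2_of_complex ` K)"
proof -
  have "(complex_of_vec2 has_derivative complex_of_vec2) (at p within vec2_of_complex ` K)"
    by (rule bounded_linear_imp_has_derivative[OF bounded_linear_complex_of_vec2])
  moreover have "(k has_derivative (*) d) (at (complex_of_vec2 p) within complex_of_vec2 ` vec2_of_complex ` K)"
    using assms by (simp add: has_field_derivative_def)
  ultimately have "((\<lambda>p. k (complex_of_vec2 p)) has_derivative (\<lambda>q. d * complex_of_vec2 q)) (at p within vec2_of_complex ` K)"
    using diff_chain_within[of complex_of_vec2 complex_of_vec2 p "vec2_of_complex ` K" k "(*) d"]
    by (simp add: o_def)
  then show ?thesis
    by (rule bounded_linear.has_derivative[OF bounded_linear_vec2_of_complex])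
qed

text \<open>In real coordinates, multiplication by \<open>d\<close> is a rotation combined with
  scaling by \<open>cmod d\<close>.\<close>

lemma det_conj_vec2:
  "det (matrix (\<lambda>q. vec2_of_complex (d * complex_of_vec2 q))) = (cmod d)\<^sup>2"
  unfolding cmod_power2
  by (simp add: det_2 matrix_def complex_of_vec2_def axis_def power2_eq_square)

lemma set_integral_injective_image:
  fixes f k :: "complex \<Rightarrow> complex"
  assumes K: "compact K"
    and der: "\<And>z. z \<in> K \<Longrightarrow> (k has_field_derivative k' z) (at z within K)"
    and inj: "inj_on k K" and f: "continuous_on (k ` K) f" and k': "continuous_on K k'"
  shows "(LINT w:k ` K|lborel. f w) = (LINT z:K|lborel. (cmod (k' z))\<^sup>2 *\<^sub>R f (k z))"
proof -
  let ?g = "\<lambda>p. vec2_of_complex (k (complex_of_vec2 p))"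
  let ?f = "\<lambda>p. vec2_of_complex (f (complex_of_vec2 p))"
  let ?K = "vec2_of_complex ` K"
  have contk: "continuous_on K k"
    using der DERIV_continuous_on by blast
  have kK: "compact (k ` K)"
    by (rule compact_continuous_image[OF contk K])
  have img: "?g ` ?K = vec2_of_complex ` k ` K"
    by (auto simp: image_image)
  have K': "compact ?K"
    by (intro compact_continuous_image continuous_intros K)
  have inj': "inj_on ?g ?K"
    using inj inj_vec2_of_complex by (auto simp: inj_on_def)
  have der': "(?g has_derivative (\<lambda>q. vec2_of_complex (k' (complex_of_vec2 p) * complex_of_vec2 q))) (at p within ?K)"
    if "p \<in> ?K" for p
    using that by (intro has_derivative_conj_vec2 der) auto
  have cont: "continuous_on K (\<lambda>z. (cmod (k' z))\<^sup>2 *\<^sub>R f (k z))"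
    by (intro continuous_intros continuous_on_compose2[OF f] contk k') auto
  have eq: "\<bar>det (matrix (\<lambda>q. vec2_of_complex (k' (complex_of_vec2 p) * complex_of_vec2 q)))\<bar> *\<^sub>R ?f (?g p)
    = vec2_of_complex ((cmod (k' (complex_of_vec2 p)))\<^sup>2 *\<^sub>R f (k (complex_of_vec2 p)))" for p
    by (simp add: det_conj_vec2 linear_cmul[OF linear_vec2_of_complex])
  have "vec2_of_complex (LINT z:K|lborel. (cmod (k' z))\<^sup>2 *\<^sub>R f (k z)) = integral (?g ` ?K) ?f"
    using has_absolute_integral_change_of_variables_compact[OF K' der' inj', of ?f]
      set_integral_vec2[OF K cont]
    unfolding eq by metis
  also have "\<dots> = vec2_of_complex (LINT w:k ` K|lborel. f w)"
    unfolding img by (rule set_integral_vec2[OF kK f])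
  finally show ?thesis
    using inj_vec2_of_complex by (auto dest: injD)
qed

section \<open>The Ahlfors-Beurling estimate\<close>

lemma measure_cball_complex: "0 \<le> \<rho> \<Longrightarrow> measure lborel (cball (c::complex) \<rho>) = pi * \<rho>\<^sup>2"
  using content_cball[of \<rho> c] by (simp add: eval_unit_ball_vol)

lemma emeasure_compact_finite: "compact K \<Longrightarrow> emeasure lborel K < \<infinity>"
  using emeasure_bounded_finite compact_imp_bounded by blast

lemma set_integral_const_compact:
  fixes K :: "'a::euclidean_space set" and c :: "'b::{banach, second_countable_topology}"
  assumes "compact K"
  shows "(LINT w:K|lborel. c) = measure lborel K *\<^sub>R c"
  using assms emeasure_compact_finite[OF assms]
  by (simp add: set_lebesgue_integral_def borel_compact less_top[symmetric])

text \<open>Multiplication by a unimodular \<zeta> with \<open>\<zeta> ^ Suc n = -1\<close>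
  preserves the disc and areas but reverses the sign of the integrand, so the integral equals its
  own negative.\<close>

lemma set_integral_cball_power:
  "(LINT w:cball 0 \<rho>|lborel. w ^ Suc n) = (0::complex)"
proof -
  define \<zeta> :: complex where "\<zeta> = cis (pi / Suc n)"
  have \<zeta>1: "cmod \<zeta> = 1"
    by (simp add: \<zeta>_def)
  have "\<zeta> ^ Suc n = cis (real (Suc n) * (pi / real (Suc n)))"
    unfolding \<zeta>_def by (rule Complex.DeMoivre)
  then have \<zeta>n: "\<zeta> ^ Suc n = -1"
    by simp
  have img: "(\<lambda>z. \<zeta> * z) ` cball 0 \<rho> = cball 0 \<rho>"
  proof (intro equalityI subsetI)
    fix z :: complex assume z: "z \<in> cball 0 \<rho>"
    have "z = \<zeta> * (z / \<zeta>)" using \<zeta>1 by auto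
    moreover have "z / \<zeta> \<in> cball 0 \<rho>" using z \<zeta>1 by (simp add: norm_divide)
    ultimately show "z \<in> (\<lambda>z. \<zeta> * z) ` cball 0 \<rho>" by blast
  qed (auto simp: norm_mult \<zeta>1)
  have "(LINT w:cball 0 \<rho>|lborel. w ^ Suc n) = (LINT w:(\<lambda>z. \<zeta> * z) ` cball 0 \<rho>|lborel. w ^ Suc n)"
    by (simp add: img)
  also have "\<dots> = (LINT z:cball 0 \<rho>|lborel. (cmod \<zeta>)\<^sup>2 *\<^sub>R (\<zeta> * z) ^ Suc n)"
    using \<zeta>1 by (intro set_integral_injective_image) (auto intro!: derivative_eq_intros inj_onI continuous_intros)
  also have "\<dots> = (LINT z:cball 0 \<rho>|lborel. - (z ^ Suc n))"
    unfolding power_mult_distrib \<zeta>n \<zeta>1 by simp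
  also have "\<dots> = - (LINT z:cball 0 \<rho>|lborel. z ^ Suc n)"
    by (simp add: set_lebesgue_integral_def)
  finally show ?thesis
    by simp
qed

text \<open>Termwise integration of the Taylor series; by \<open>set_integral_cball_power\<close>
  only the constant term contributes.\<close>

lemma area_mean_value_0:
  assumes f: "f holomorphic_on ball 0 R" and \<rho>: "0 \<le> \<rho>" "\<rho> < R"
  shows "(LINT w:cball 0 \<rho>|lborel. f w) = (pi * \<rho>\<^sup>2) *\<^sub>R f 0"
proof -
  let ?K = "cball (0::complex) \<rho>"
  define c where "c n = (deriv ^^ n) f 0 / fact n" for n
  have sums: "(\<lambda>n. c n * w ^ n) sums f w" if "w \<in> ball 0 R" for w
    using holomorphic_power_series[OF f that] by (simp add: c_def)
  \<comment> \<open>Convergence at the midpoint of \<rho> and \<open>R\<close> gives absolute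
    convergence at \<rho>, the domination that permits exchanging sum and integral.\<close>
  have "summable (\<lambda>n. norm (c n * complex_of_real \<rho> ^ n))"
  proof (rule powser_insidea)
    show "summable (\<lambda>n. c n * complex_of_real ((\<rho> + R) / 2) ^ n)"
      using \<rho> by (intro sums_summable[OF sums]) (simp only: mem_ball_0 norm_of_real, simp)
    show "norm (complex_of_real \<rho>) < norm (complex_of_real ((\<rho> + R) / 2))"
      unfolding norm_of_real using \<rho> by simp
  qed
  then have summ: "summable (\<lambda>n. norm (c n) * \<rho> ^ n)"
    using \<rho> by (simp add: norm_mult norm_power)
  let ?g = "\<lambda>n w. indicator ?K w *\<^sub>R (c n * w ^ n)"
  have int: "integrable lborel (?g n)" for n
  proof -
    have "continuous_on ?K (\<lambda>w. c n * w ^ n)"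
      by (intro continuous_intros)
    from set_integrable_compact[OF compact_cball this] show ?thesis
      by (simp add: set_integrable_def)
  qed
  have bound: "norm (?g n w) \<le> indicator ?K w * (norm (c n) * \<rho> ^ n)" for n w
    by (auto simp: indicator_def norm_mult norm_power intro!: mult_left_mono power_mono)
  have AEs: "AE w in lborel. summable (\<lambda>n. norm (?g n w))"
  proof (rule AE_I2)
    fix w :: complex
    show "summable (\<lambda>n. norm (?g n w))"
    proof (rule summable_comparison_test')
      show "summable (\<lambda>n. indicator ?K w * (norm (c n) * \<rho> ^ n))"
        by (rule summable_mult[OF summ])
      show "norm (norm (?g n w)) \<le> indicator ?K w * (norm (c n) * \<rho> ^ n)" for n
        unfolding real_norm_def abs_norm_cancel by (rule bound)
    qed
  qed
  have "norm (LINT w|lborel. norm (?g n w)) \<le> measure lborel ?K * (norm (c n) * \<rho> ^ n)" for n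
  proof -
    have "(LINT w|lborel. norm (?g n w)) \<le> (LINT w:?K|lborel. norm (c n) * \<rho> ^ n)"
      unfolding set_lebesgue_integral_def real_scaleR_def
    proof (rule integral_mono)
      show "integrable lborel (\<lambda>w. norm (?g n w))"
        using int by (rule integrable_norm)
      show "integrable lborel (\<lambda>w. indicator ?K w * (norm (c n) * \<rho> ^ n))"
        using set_integrable_compact[of ?K "\<lambda>_. norm (c n) * \<rho> ^ n"]
        by (simp add: set_integrable_def)
    qed (rule bound)
    also have "\<dots> = measure lborel ?K * (norm (c n) * \<rho> ^ n)"
      using set_integral_const_compact[OF compact_cball, of 0 \<rho> "norm (c n) * \<rho> ^ n"]
      by (simp only: real_scaleR_def)
    finally show ?thesis by simp
  qed
  then have sumi: "summable (\<lambda>n. LINT w|lborel. norm (?g n w))"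
    by (intro summable_comparison_test'[OF summable_mult[OF summ]])
  have "(LINT w:?K|lborel. f w) = (LINT w|lborel. (\<Sum>n. ?g n w))"
    unfolding set_lebesgue_integral_def
  proof (rule Bochner_Integration.integral_cong[OF refl])
    fix w :: complex
    show "indicator ?K w *\<^sub>R f w = (\<Sum>n. ?g n w)"
      using sums[of w] \<rho> by (auto simp: indicator_def sums_iff)
  qed
  also have "\<dots> = (\<Sum>n. LINT w|lborel. ?g n w)"
    using int AEs sumi by (rule integral_suminf)
  also have "\<dots> = (LINT w|lborel. ?g 0 w)"
  proof -
    have "(LINT w|lborel. ?g (Suc n) w) = 0" for n
    proof -
      have "(LINT w|lborel. ?g (Suc n) w) = (LINT w|lborel. c (Suc n) * (indicator ?K w *\<^sub>R w ^ Suc n))"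
        by (simp add: mult_ac)
      also have "\<dots> = c (Suc n) * (LINT w:?K|lborel. w ^ Suc n)"
        unfolding set_lebesgue_integral_def by (rule integral_mult_right_zero)
      finally show ?thesis
        using set_integral_cball_power by simp
    qed
    then have "(LINT w|lborel. ?g n w) = 0" if "n \<notin> {0}" for n
      using that by (cases n) auto
    from suminf_finite[OF _ this, of "{0}" "\<lambda>n. n"] show ?thesis by simp
  qed
  also have "\<dots> = (LINT w:?K|lborel. f 0)"
    by (simp add: set_lebesgue_integral_def c_def)
  finally show ?thesis
    using \<rho> by (simp only: set_integral_const_compact[OF compact_cball] measure_cball_complex)
qed

lemma set_integral_affine_image:
  fixes f :: "complex \<Rightarrow> complex"
  assumes K: "compact K" and f: "continuous_on ((\<lambda>z. l * z + c) ` K) f" and l: "cmod l = 1"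
  shows "(LINT w:(\<lambda>z. l * z + c) ` K|lborel. f w) = (LINT z:K|lborel. f (l * z + c))"
proof -
  have "(LINT w:(\<lambda>z. l * z + c) ` K|lborel. f w) = (LINT z:K|lborel. (cmod l)\<^sup>2 *\<^sub>R f (l * z + c))"
    using l by (intro set_integral_injective_image K f) (auto intro!: derivative_eq_intros inj_onI continuous_intros)
  then show ?thesis
    using l by simp
qed

lemma area_mean_value:
  assumes f: "f holomorphic_on ball a R" and \<rho>: "0 \<le> \<rho>" "\<rho> < R"
  shows "(LINT w:cball a \<rho>|lborel. f w) = (pi * \<rho>\<^sup>2) *\<^sub>R f a"
proof -
  have img: "(\<lambda>z. 1 * z + a) ` cball 0 \<rho> = cball a \<rho>"
    using cball_translation[of a 0 \<rho>] by (simp add: add.commute)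
  have "continuous_on (cball a \<rho>) f"
    using \<rho> by (intro holomorphic_on_imp_continuous_on holomorphic_on_subset[OF f]) auto
  then have "(LINT w:cball a \<rho>|lborel. f w) = (LINT z:cball 0 \<rho>|lborel. f (1 * z + a))"
    using set_integral_affine_image[of "cball 0 \<rho>" 1 a f] unfolding img by simp
  also have "\<dots> = (pi * \<rho>\<^sup>2) *\<^sub>R f (1 * 0 + a)"
  proof (rule area_mean_value_0[OF _ \<rho>])
    have "f \<circ> (\<lambda>z. 1 * z + a) holomorphic_on ball 0 R"
      by (intro holomorphic_on_compose_gen[OF _ f] holomorphic_intros) (auto simp: dist_norm)
    then show "(\<lambda>z. f (1 * z + a)) holomorphic_on ball 0 R"
      by (simp add: o_def)
  qed
  finally show ?thesis by simp
qed

lemma of_real_measure_compact: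
  "compact K \<Longrightarrow> complex_of_real (measure lborel K) = (LINT w:K|lborel. 1)"
  by (simp add: set_integral_const_compact of_real_def)

text \<open>Among sets of area \<open>\<pi> a\<^sup>2\<close> the integral is largest on the disc of centre and radius \<open>a\<close>, because this
  disc is the superlevel set \<open>Re (1 / w) > 1 / (2 * a)\<close>.\<close>

lemma set_integral_Re_inverse_le:
  assumes K: "compact K" and 0: "0 \<notin> K"
  shows "(LINT w:K|lborel. Re (1 / w)) \<le> sqrt (pi * measure lborel K)"
proof (cases "measure lborel K = 0")
  case True
  have "emeasure lborel K = 0"
    using True emeasure_compact_finite[OF K] by (auto simp: measure_def enn2real_eq_0_iff)
  then have "AE w in lborel. w \<notin> K"
    using K by (intro AE_not_in) (auto simp: null_sets_def borel_compact)
  then have "AE w in lborel. indicator K w *\<^sub>R Re (1 / w) = 0"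
    by eventually_elim simp
  then have "(LINT w:K|lborel. Re (1 / w)) = 0"
    unfolding set_lebesgue_integral_def by (rule integral_eq_zero_AE)
  then show ?thesis using True by simp
next
  case False
  define A where "A = measure lborel K"
  define a where "a = sqrt (A / pi)"
  have A: "A > 0" using False by (simp add: A_def less_le)
  then have a: "a > 0" and Aa: "A = pi * a\<^sup>2"
    by (simp_all add: a_def)
  obtain \<delta> where \<delta>: "\<delta> > 0" "\<And>w. w \<in> K \<Longrightarrow> \<delta> \<le> cmod w"
    using separate_point_closed[OF compact_imp_closed[OF K] 0] by auto
  define \<phi> where "\<phi> w = Re (1 / w) - 1 / (2 * a)" for w
  have \<phi>_neg: "\<phi> w \<le> 0" if "w \<notin> cball (of_real a) a" "w \<noteq> 0" for w
  proof -
    have "a\<^sup>2 \<le> (cmod (of_real a - w))\<^sup>2"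
      using that a by (intro power_mono) (auto simp: dist_norm)
    then have "2 * a * Re w \<le> (cmod w)\<^sup>2"
      unfolding cmod_power2 by (simp add: power2_eq_square algebra_simps)
    then have "Re w / (cmod w)\<^sup>2 \<le> 1 / (2 * a)"
      using a that by (simp add: field_simps)
    moreover have "Re (1 / w) = Re w / (cmod w)\<^sup>2"
      using that by (simp add: Re_divide cmod_power2)
    ultimately show ?thesis
      by (simp add: \<phi>_def)
  qed
  have \<phi>_nonneg: "0 \<le> \<phi> w" if "w \<in> cball (of_real a) a" "w \<noteq> 0" for w
  proof -
    have "(cmod (of_real a - w))\<^sup>2 \<le> a\<^sup>2"
      using that a by (intro power_mono) (auto simp: dist_norm)
    then have "(cmod w)\<^sup>2 \<le> 2 * a * Re w"
      unfolding cmod_power2 by (simp add: power2_eq_square algebra_simps)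
    then have "1 / (2 * a) \<le> Re w / (cmod w)\<^sup>2"
      using a that by (simp add: field_simps)
    moreover have "Re (1 / w) = Re w / (cmod w)\<^sup>2"
      using that by (simp add: Re_divide cmod_power2)
    ultimately show ?thesis
      by (simp add: \<phi>_def)
  qed
  have \<phi>_le: "\<phi> w \<le> 1 / \<delta>" if "w \<in> K" for w
  proof -
    have "Re (1 / w) \<le> cmod (1 / w)" by (rule complex_Re_le_cmod)
    also have "\<dots> \<le> 1 / \<delta>" using \<delta> that by (simp add: norm_divide frac_le)
    finally have "Re (1 / w) \<le> 1 / \<delta>" .
    moreover have "0 < 1 / (2 * a)" using a by simp
    ultimately show ?thesis unfolding \<phi>_def by linarith
  qed
  have cont: "continuous_on S \<phi>" if "0 \<notin> S" for S
    unfolding \<phi>_def using that by (intro continuous_intros) (auto simp: a)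
  have ball0: "0 \<notin> cball (complex_of_real a) \<rho>" if "\<rho> < a" for \<rho>
    using that a by simp
  \<comment> \<open>The disc of centre and radius \<open>a\<close> has the singularity 0 of
    \<open>1 / w\<close> on its boundary, so the mean value property is used on a smaller radius
    \<rho>. The part of \<open>K\<close> in the remaining annulus contributes at most
    \<open>1 / \<delta>\<close> times the area of the annulus, which vanishes as \<rho> tends to
    \<open>a\<close>.\<close>
  have key: "(LINT w:K|lborel. \<phi> w) \<le> pi * \<rho>\<^sup>2 / (2 * a) + pi * (a\<^sup>2 - \<rho>\<^sup>2) / \<delta>"
    if \<rho>: "0 \<le> \<rho>" "\<rho> < a" for \<rho>
  proof -
    let ?B = "cball (complex_of_real a) \<rho>" and ?C = "cball (complex_of_real a) a"
    have intK: "integrable lborel (\<lambda>w. indicator K w *\<^sub>R \<phi> w)"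
      using set_integrable_compact[OF K cont[OF 0]] by (simp add: set_integrable_def)
    have intB: "integrable lborel (\<lambda>w. indicator ?B w *\<^sub>R \<phi> w)"
      using set_integrable_compact[OF compact_cball cont[OF ball0[OF \<rho>(2)]]] by (simp add: set_integrable_def)
    have intD: "integrable lborel (\<lambda>w. indicator ?C w *\<^sub>R (1 / \<delta>))" "integrable lborel (\<lambda>w. indicator ?B w *\<^sub>R (1 / \<delta>))"
      using set_integrable_compact[of ?C "\<lambda>_. 1 / \<delta>"] set_integrable_compact[of ?B "\<lambda>_. 1 / \<delta>"]
      by (simp_all add: set_integrable_def)
    have "(LINT w:K|lborel. \<phi> w) \<le>
       (LINT w|lborel. indicator ?B w *\<^sub>R \<phi> w + (indicator ?C w *\<^sub>R (1 / \<delta>) - indicator ?B w *\<^sub>R (1 / \<delta>)))"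
      unfolding set_lebesgue_integral_def
    proof (rule integral_mono[OF intK])
      show "integrable lborel (\<lambda>w. indicator ?B w *\<^sub>R \<phi> w + (indicator ?C w *\<^sub>R (1 / \<delta>) - indicator ?B w *\<^sub>R (1 / \<delta>)))"
        using intB intD by (intro Bochner_Integration.integrable_add Bochner_Integration.integrable_diff)
      fix w :: complex
      have BC: "w \<in> ?B \<Longrightarrow> w \<in> ?C" using \<rho> by auto
      show "indicator K w *\<^sub>R \<phi> w \<le> indicator ?B w *\<^sub>R \<phi> w + (indicator ?C w *\<^sub>R (1 / \<delta>) - indicator ?B w *\<^sub>R (1 / \<delta>))"
        using BC \<phi>_nonneg[of w] \<phi>_neg[of w] \<phi>_le[of w] \<delta>(1) 0 ball0[OF \<rho>(2)]
        by (cases "w \<in> K"; cases "w \<in> ?B"; cases "w \<in> ?C"; cases "w = 0") (auto simp: indicator_def simp del: mem_cball)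
    qed
    also have "\<dots> = (LINT w:?B|lborel. \<phi> w) + ((LINT w:?C|lborel. 1 / \<delta>) - (LINT w:?B|lborel. 1 / \<delta>))"
      unfolding set_lebesgue_integral_def
      using intB intD by (simp only: Bochner_Integration.integral_add Bochner_Integration.integral_diff Bochner_Integration.integrable_diff)
    also have "(LINT w:?C|lborel. 1 / \<delta>) - (LINT w:?B|lborel. 1 / \<delta>) = pi * (a\<^sup>2 - \<rho>\<^sup>2) / \<delta>"
      using \<rho> by (simp only: set_integral_const_compact[OF compact_cball] measure_cball_complex)
                  (simp add: right_diff_distrib diff_divide_distrib)
    also have "(LINT w:?B|lborel. \<phi> w) = pi * \<rho>\<^sup>2 / (2 * a)"
    proof -
      have "set_integrable lborel ?B (\<lambda>w. 1 / w)"
        using ball0[OF \<rho>(2)] by (intro set_integrable_compact compact_cball continuous_intros) auto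
      then have Re: "(LINT w:?B|lborel. Re (1 / w)) = Re (LINT w:?B|lborel. 1 / w)"
           and intRe: "set_integrable lborel ?B (\<lambda>w. Re (1 / w))"
        unfolding set_lebesgue_integral_def set_integrable_def
        by (auto simp flip: integral_Re dest: integrable_Re)
      have "(LINT w:?B|lborel. \<phi> w) = (LINT w:?B|lborel. Re (1 / w)) - (LINT w:?B|lborel. 1 / (2 * a))"
        unfolding \<phi>_def
        by (rule set_integral_diff(2)[OF intRe set_integrable_compact]) auto
      also have "(LINT w:?B|lborel. 1 / w) = (pi * \<rho>\<^sup>2) *\<^sub>R (1 / complex_of_real a)"
        using \<rho> by (intro area_mean_value[where R = a] holomorphic_intros) auto
      then have "(LINT w:?B|lborel. Re (1 / w)) = pi * \<rho>\<^sup>2 / a"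
        unfolding Re by (simp add: Re_divide_of_real)
      finally show ?thesis
        using \<rho> a by (simp add: set_integral_const_compact measure_cball_complex field_simps)
    qed
    finally show ?thesis .
  qed
  have "((\<lambda>\<rho>. pi * \<rho>\<^sup>2 / (2 * a) + pi * (a\<^sup>2 - \<rho>\<^sup>2) / \<delta>) \<longlongrightarrow> pi * a\<^sup>2 / (2 * a) + pi * (a\<^sup>2 - a\<^sup>2) / \<delta>) (at_left a)"
    using a \<delta> by (intro tendsto_intros) auto
  moreover have "\<forall>\<^sub>F \<rho> in at_left a. (LINT w:K|lborel. \<phi> w) \<le> pi * \<rho>\<^sup>2 / (2 * a) + pi * (a\<^sup>2 - \<rho>\<^sup>2) / \<delta>"
    using eventually_at_left_real[OF a] by eventually_elim (use key in auto)
  ultimately have "(LINT w:K|lborel. \<phi> w) \<le> pi * a\<^sup>2 / (2 * a) + pi * (a\<^sup>2 - a\<^sup>2) / \<delta>"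
    by (rule tendsto_lowerbound) simp
  also have "\<dots> = pi * a / 2"
    using a by (simp add: power2_eq_square)
  finally have 1: "(LINT w:K|lborel. \<phi> w) \<le> pi * a / 2" .
  \<comment> \<open>Adding back the subtracted constant contributes
    \<open>A / (2 * a) = pi * a / 2\<close>, because \<open>K\<close> has the area of the comparison
    disc.\<close>
  have "(LINT w:K|lborel. \<phi> w) = (LINT w:K|lborel. Re (1 / w)) - (LINT w:K|lborel. 1 / (2 * a))"
    unfolding \<phi>_def using 0
    by (intro set_integral_diff set_integrable_compact K continuous_intros) auto
  also have "(LINT w:K|lborel. 1 / (2 * a)) = A * (1 / (2 * a))"
    using set_integral_const_compact[OF K, of "1 / (2 * a)"] by (simp add: A_def)
  also have "A * (1 / (2 * a)) = pi * a / 2"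
    using a by (simp add: Aa power2_eq_square)
  finally have "(LINT w:K|lborel. Re (1 / w)) \<le> pi * a"
    using 1 by simp
  also have "pi * a = sqrt (pi * A)"
    using a by (intro real_sqrt_unique[symmetric]) (auto simp: Aa power2_eq_square)
  finally show ?thesis by (simp add: A_def)
qed

text \<open>Translating \<zeta> to 0 and rotating makes the integral real and nonnegative, so that
  its modulus is the integral of a real part.\<close>

lemma Ahlfors_Beurling:
  assumes K: "compact K" and \<zeta>: "\<zeta> \<notin> K"
  shows "cmod (LINT w:K|lborel. 1 / (w - \<zeta>)) \<le> sqrt (pi * measure lborel K)"
proof -
  define I where "I = (LINT w:K|lborel. 1 / (w - \<zeta>))"
  \<comment> \<open>\<open>l\<close> is the direction of \<open>I\<close>; rotating \<open>K\<close>
    by \<open>l\<close> divides the integral by \<open>l\<close> and so turns \<open>I\<close> into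
    \<open>cmod I\<close>.\<close>
  obtain l where l: "cmod l = 1" "I = l * of_real (cmod I)"
    using that[of "cis (Arg I)"] rcis_cmod_Arg[of I] by (auto simp: rcis_def mult.commute)
  define g where "g z = l * z + - l * \<zeta>" for z
  have l0: "l \<noteq> 0" using l by auto
  have gK: "compact (g ` K)" unfolding g_def
    by (intro compact_continuous_image continuous_intros K)
  have g0: "0 \<notin> g ` K"
    using \<zeta> l0 by (auto simp: g_def algebra_simps)
  have area: "measure lborel (g ` K) = measure lborel K"
  proof -
    have "complex_of_real (measure lborel (g ` K)) = complex_of_real (measure lborel K)"
      unfolding of_real_measure_compact[OF gK] of_real_measure_compact[OF K]
      unfolding g_def by (rule set_integral_affine_image[OF K _ l(1)]) auto
    then show ?thesis by simp
  qed
  have cont: "continuous_on (g ` K) (\<lambda>w. 1 / w)"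
    using g0 by (intro continuous_intros) auto
  have "(LINT w:g ` K|lborel. 1 / w) = (LINT z:K|lborel. 1 / g z)"
    using cont unfolding g_def by (rule set_integral_affine_image[OF K _ l(1)])
  also have "\<dots> = (LINT z:K|lborel. (1 / l) * (1 / (z - \<zeta>)))"
    by (simp add: g_def right_diff_distrib[symmetric])
  also have "\<dots> = (1 / l) * I"
    unfolding I_def by (rule set_integral_mult_right)
  also have "\<dots> = of_real (cmod I)"
    by (metis l(2) l0 nonzero_mult_div_cancel_left times_divide_eq_left mult_1)
  finally have eq: "(LINT w:g ` K|lborel. 1 / w) = of_real (cmod I)" .
  have "cmod I = Re (LINT w:g ` K|lborel. 1 / w)"
    unfolding eq by simp
  also have "\<dots> = (LINT w:g ` K|lborel. Re (1 / w))"
    using set_integrable_compact[OF gK cont]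
    unfolding set_lebesgue_integral_def set_integrable_def by (simp flip: integral_Re)
  also have "\<dots> \<le> sqrt (pi * measure lborel (g ` K))"
    by (rule set_integral_Re_inverse_le[OF gK g0])
  finally show ?thesis by (simp add: area I_def)
qed

section \<open>Area inequalities\<close>

lemma norm_set_integral_compact_le:
  fixes f :: "complex \<Rightarrow> complex"
  assumes K: "compact K" and f: "continuous_on K f" and B: "\<And>w. w \<in> K \<Longrightarrow> cmod (f w) \<le> B"
  shows "cmod (LINT w:K|lborel. f w) \<le> B * measure lborel K"
proof -
  have "cmod (LINT w:K|lborel. f w) \<le> (LINT w:K|lborel. cmod (f w))"
    by (rule set_integral_norm_bound[OF set_integrable_compact[OF K f]])
  also have "\<dots> \<le> (LINT w:K|lborel. B)"
    by (rule set_integral_mono[OF set_integrable_compact[OF K] set_integrable_compact[OF K]])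
       (auto intro!: continuous_intros f B)
  also have "\<dots> = B * measure lborel K"
    using set_integral_const_compact[OF K, of B] by (simp only: real_scaleR_def mult.commute)
  finally show ?thesis .
qed

text \<open>The error of the difference quotient is the integral of
  \<open>(y - z) / ((w - y) * (w - z)\<^sup>2)\<close>. If \<open>K\<close> stays at distance
  \<delta> from \<open>z\<close> and \<open>y\<close> is within \<open>\<delta> / 2\<close> of
  \<open>z\<close>, the denominator is at least \<open>\<delta> ^ 3 / 2\<close> in modulus, so the
  error is of order \<open>cmod (y - z)\<close>.\<close>

lemma area_Cauchy_transform_has_derivative:
  fixes K :: "complex set"
  assumes K: "compact K" and z: "z \<notin> K"
  shows "((\<lambda>\<zeta>. LINT w:K|lborel. 1 / (w - \<zeta>)) has_field_derivative
           (LINT w:K|lborel. 1 / (w - z)\<^sup>2)) (at z)"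
proof -
  let ?h = "\<lambda>\<zeta>. LINT w:K|lborel. 1 / (w - \<zeta>)" and ?D = "LINT w:K|lborel. 1 / (w - z)\<^sup>2"
  obtain \<delta> where \<delta>: "\<delta> > 0" "\<And>w. w \<in> K \<Longrightarrow> \<delta> \<le> dist z w"
    using separate_point_closed[OF compact_imp_closed[OF K] z] by auto
  have bound: "cmod ((?h y - ?h z) / (y - z) - ?D) \<le> cmod (y - z) * (2 / \<delta> ^ 3 * measure lborel K)"
    if y: "y \<noteq> z" "dist y z < \<delta> / 2" for y
  proof -
    have yK: "\<delta> / 2 \<le> cmod (w - y)" if "w \<in> K" for w
      using \<delta>(2)[OF that] dist_triangle[of z w y] y(2) by (simp add: dist_commute dist_norm)
    have zK: "\<delta> \<le> cmod (w - z)" if "w \<in> K" for w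
      using \<delta>(2)[OF that] by (simp add: dist_norm norm_minus_commute)
    have ne: "w \<noteq> y" "w \<noteq> z" if "w \<in> K" for w
      using yK[OF that] zK[OF that] \<delta>(1) by auto
    have c: "continuous_on K (\<lambda>w. 1 / (w - y))" "continuous_on K (\<lambda>w. 1 / (w - z))"
         "continuous_on K (\<lambda>w. (y - z) * (1 / (w - z)\<^sup>2))"
         "continuous_on K (\<lambda>w. (y - z) / ((w - y) * (w - z)\<^sup>2))"
      using ne by (auto intro!: continuous_intros)
    note si = c[THEN set_integrable_compact[OF K]]
    have "?h y - ?h z - (y - z) * ?D = (LINT w:K|lborel. 1 / (w - y) - 1 / (w - z) - (y - z) * (1 / (w - z)\<^sup>2))"
      using si by (simp only: set_integral_diff set_integral_mult_right)
    also have "\<dots> = (LINT w:K|lborel. (y - z) * ((y - z) / ((w - y) * (w - z)\<^sup>2)))"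
    proof (rule set_lebesgue_integral_cong)
      show "K \<in> sets lborel" using K by (simp add: borel_compact)
      have eq: "1 / p - 1 / q - d * (1 / q\<^sup>2) = d * (d / (p * q\<^sup>2))" if "p \<noteq> 0" "q \<noteq> 0" "q = p + d" for p q d :: complex
        using that by (simp add: divide_simps) (simp add: power2_eq_square algebra_simps)
      show "\<forall>w. w \<in> K \<longrightarrow> 1 / (w - y) - 1 / (w - z) - (y - z) * (1 / (w - z)\<^sup>2) = (y - z) * ((y - z) / ((w - y) * (w - z)\<^sup>2))"
        using ne by (intro allI impI eq) auto
    qed
    also have "\<dots> = (y - z) * (LINT w:K|lborel. (y - z) / ((w - y) * (w - z)\<^sup>2))"
      by (rule set_integral_mult_right)
    finally have "(?h y - ?h z) / (y - z) - ?D = (LINT w:K|lborel. (y - z) / ((w - y) * (w - z)\<^sup>2))"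
      using y(1) by (simp add: field_simps)
    moreover have "cmod (LINT w:K|lborel. (y - z) / ((w - y) * (w - z)\<^sup>2)) \<le> (cmod (y - z) / (\<delta> / 2 * \<delta>\<^sup>2)) * measure lborel K"
    proof (rule norm_set_integral_compact_le[OF K c(4)])
      fix w assume w: "w \<in> K"
      have "\<delta> / 2 * \<delta>\<^sup>2 \<le> cmod (w - y) * (cmod (w - z))\<^sup>2"
        using yK[OF w] zK[OF w] \<delta>(1) by (intro mult_mono power_mono) auto
      then show "cmod ((y - z) / ((w - y) * (w - z)\<^sup>2)) \<le> cmod (y - z) / (\<delta> / 2 * \<delta>\<^sup>2)"
        unfolding norm_divide norm_mult norm_power using \<delta>(1) by (intro frac_le) auto
    qed
    ultimately show ?thesis
      by (simp add: power2_eq_square power3_eq_cube)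
  qed
  have "((\<lambda>y. (?h y - ?h z) / (y - z) - ?D) \<longlongrightarrow> 0) (at z)"
  proof (rule Lim_null_comparison)
    show "\<forall>\<^sub>F y in at z. norm ((?h y - ?h z) / (y - z) - ?D) \<le> cmod (y - z) * (2 / \<delta> ^ 3 * measure lborel K)"
      unfolding eventually_at using bound \<delta>(1) by (intro exI[of _ "\<delta> / 2"]) auto
    have "((\<lambda>y. cmod (y - z) * (2 / \<delta> ^ 3 * measure lborel K)) \<longlongrightarrow> cmod (z - z) * (2 / \<delta> ^ 3 * measure lborel K)) (at z)"
      by (intro tendsto_intros)
    then show "((\<lambda>y. cmod (y - z) * (2 / \<delta> ^ 3 * measure lborel K)) \<longlongrightarrow> 0) (at z)"
      by simp
  qed
  then show ?thesis
    unfolding has_field_derivative_iff by (rule LIM_zero_cancel)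
qed

text \<open>As \<open>\<zeta> / (w - \<zeta>) + 1 = w / (w - \<zeta>)\<close>, the deviation from
  the limit is of order \<open>1 / cmod \<zeta>\<close>. This limit supplies the derivative at 0
  once \<open>1 / F\<close> is substituted for \<zeta>.\<close>

lemma area_Cauchy_transform_at_infinity:
  fixes K :: "complex set"
  assumes K: "compact K"
  shows "((\<lambda>\<zeta>. \<zeta> * (LINT w:K|lborel. 1 / (w - \<zeta>))) \<longlongrightarrow> - of_real (measure lborel K)) at_infinity"
proof -
  obtain B where B: "B > 0" "\<And>w. w \<in> K \<Longrightarrow> cmod w \<le> B"
    using compact_imp_bounded[OF K] by (auto simp: bounded_pos)
  let ?A = "complex_of_real (measure lborel K)"
  have bound: "cmod (\<zeta> * (LINT w:K|lborel. 1 / (w - \<zeta>)) - (- ?A)) \<le> cmod (inverse \<zeta>) * (2 * B * measure lborel K)"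
    if \<zeta>: "2 * B \<le> cmod \<zeta>" for \<zeta>
  proof -
    have far: "cmod \<zeta> / 2 \<le> cmod (w - \<zeta>)" if "w \<in> K" for w
      using B(2)[OF that] \<zeta> norm_triangle_ineq2[of \<zeta> w] by (simp add: norm_minus_commute)
    have \<zeta>0: "cmod \<zeta> > 0" using \<zeta> B by linarith
    have ne: "w \<noteq> \<zeta>" if "w \<in> K" for w
      using far[OF that] \<zeta>0 by auto
    have c: "continuous_on K (\<lambda>w. \<zeta> * (1 / (w - \<zeta>)))" "continuous_on K (\<lambda>w. 1 :: complex)"
         "continuous_on K (\<lambda>w. w / (w - \<zeta>))"
      using ne by (auto intro!: continuous_intros)
    note si = c[THEN set_integrable_compact[OF K]]
    have "\<zeta> * (LINT w:K|lborel. 1 / (w - \<zeta>)) - (- ?A) = (LINT w:K|lborel. \<zeta> * (1 / (w - \<zeta>)) + 1)"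
      using si by (simp only: set_integral_add set_integral_mult_right of_real_measure_compact[OF K] diff_minus_eq_add)
    also have "\<dots> = (LINT w:K|lborel. w / (w - \<zeta>))"
    proof (rule set_lebesgue_integral_cong)
      show "K \<in> sets lborel" using K by (simp add: borel_compact)
      show "\<forall>w. w \<in> K \<longrightarrow> \<zeta> * (1 / (w - \<zeta>)) + 1 = w / (w - \<zeta>)"
        using ne by (auto simp: divide_simps)
    qed
    also have "cmod \<dots> \<le> (B / (cmod \<zeta> / 2)) * measure lborel K"
    proof (rule norm_set_integral_compact_le[OF K c(3)])
      fix w assume w: "w \<in> K"
      show "cmod (w / (w - \<zeta>)) \<le> B / (cmod \<zeta> / 2)"
        unfolding norm_divide using B(1) B(2)[OF w] far[OF w] \<zeta>0 by (intro frac_le) auto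
    qed
    also have "(B / (cmod \<zeta> / 2)) * measure lborel K = cmod (inverse \<zeta>) * (2 * B * measure lborel K)"
      by (simp add: norm_divide field_simps)
    finally show ?thesis .
  qed
  have "((\<lambda>\<zeta>. \<zeta> * (LINT w:K|lborel. 1 / (w - \<zeta>)) - (- ?A)) \<longlongrightarrow> 0) at_infinity"
  proof (rule Lim_null_comparison)
    show "\<forall>\<^sub>F \<zeta> in at_infinity. norm (\<zeta> * (LINT w:K|lborel. 1 / (w - \<zeta>)) - (- ?A)) \<le> cmod (inverse \<zeta>) * (2 * B * measure lborel K)"
      unfolding eventually_at_infinity using bound by blast
    have "((\<lambda>\<zeta>::complex. cmod (inverse \<zeta>) * (2 * B * measure lborel K)) \<longlongrightarrow> cmod 0 * (2 * B * measure lborel K)) at_infinity"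
      by (intro tendsto_intros tendsto_inverse_0)
    then show "((\<lambda>\<zeta>::complex. cmod (inverse \<zeta>) * (2 * B * measure lborel K)) \<longlongrightarrow> 0) at_infinity"
      by simp
  qed
  then show ?thesis by (rule LIM_zero_cancel)
qed

text \<open>Cauchy's inequality on circles of radius \<rho>, with \<rho> tending to 1.\<close>

lemma norm_deriv_0_le:
  assumes f: "f holomorphic_on ball 0 1" and B: "\<And>z. z \<in> ball 0 1 \<Longrightarrow> cmod (f z) \<le> B"
  shows "cmod (deriv f 0) \<le> B"
proof -
  have B0: "cmod (deriv f 0) \<le> B / \<rho>" if \<rho>: "0 < \<rho>" "\<rho> < 1" for \<rho>
  proof -
    have "norm ((deriv ^^ 1) f 0) \<le> fact 1 * B / \<rho> ^ 1"
    proof (rule Cauchy_inequality)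
      show "f holomorphic_on ball 0 \<rho>" "continuous_on (cball 0 \<rho>) f"
        using \<rho> by (auto intro!: holomorphic_on_subset[OF f] continuous_on_subset[OF holomorphic_on_imp_continuous_on[OF f]])
    qed (use \<rho> B in auto)
    then show ?thesis by simp
  qed
  have "((\<lambda>\<rho>. B / \<rho>) \<longlongrightarrow> B / 1) (at_left 1)"
    by (intro tendsto_intros) auto
  moreover have "\<forall>\<^sub>F \<rho> in at_left 1. cmod (deriv f 0) \<le> B / \<rho>"
    using eventually_at_left_real[of 0 1] by (auto elim!: eventually_mono intro: B0)
  ultimately have "cmod (deriv f 0) \<le> B / 1"
    by (rule tendsto_lowerbound) simp
  then show ?thesis by simp
qed

text \<open>The area transform of \<open>K\<close>, composed with \<open>1 / F\<close>, is bounded by the Ahlfors-Beurling estimate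
  and has derivative \<open>- area K * F'(0)\<close> at the origin.\<close>

lemma area_omitted_by_reciprocal_le:
  assumes K: "compact K" and F: "F holomorphic_on ball 0 1" and F0: "F 0 = 0"
    and Fnz: "\<And>z. z \<in> ball 0 1 \<Longrightarrow> z \<noteq> 0 \<Longrightarrow> F z \<noteq> 0 \<and> 1 / F z \<notin> K"
  shows "measure lborel K * (cmod (deriv F 0))\<^sup>2 \<le> pi"
proof -
  define A where "A = measure lborel K"
  have A0: "0 \<le> A" by (simp add: A_def)
  define h where "h \<zeta> = (LINT w:K|lborel. 1 / (w - \<zeta>))" for \<zeta>
  \<comment> \<open>The value 0 at the origin removes the singularity: \<open>1 / F\<close> has a
    pole there and the transform vanishes at infinity.\<close>
  define H where "H z = (if z = 0 then 0 else h (1 / F z))" for z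
  have dF: "(F has_field_derivative deriv F z) (at z)" if "z \<in> ball 0 1" for z
    by (rule holomorphic_derivI[OF F open_ball that])
  have "\<exists>D. (H has_field_derivative D) (at z)" if z: "z \<in> ball 0 1" "z \<noteq> 0" for z
  proof -
    have "((\<lambda>z. 1 / F z) has_field_derivative (- deriv F z / (F z)\<^sup>2)) (at z)"
      using dF[OF z(1)] Fnz[OF z] by (auto intro!: derivative_eq_intros simp: power2_eq_square)
    moreover have "(h has_field_derivative (LINT w:K|lborel. 1 / (w - 1 / F z)\<^sup>2)) (at (1 / F z))"
      unfolding h_def using Fnz[OF z] by (intro area_Cauchy_transform_has_derivative K) auto
    ultimately have "((\<lambda>z. h (1 / F z)) has_field_derivative
        (LINT w:K|lborel. 1 / (w - 1 / F z)\<^sup>2) * (- deriv F z / (F z)\<^sup>2)) (at z)"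
      by (rule DERIV_chain2[rotated])
    then have "(H has_field_derivative
        (LINT w:K|lborel. 1 / (w - 1 / F z)\<^sup>2) * (- deriv F z / (F z)\<^sup>2)) (at z)"
    proof (rule has_field_derivative_transform_within_open)
      show "open (- {0::complex})" by auto
    qed (use z in \<open>auto simp: H_def\<close>)
    then show ?thesis by blast
  qed
  \<comment> \<open>Here \<open>H z / z\<close> is the product of
    \<open>(1 / F z) * h (1 / F z)\<close>, which tends to \<open>- A\<close>, and
    \<open>F z / z\<close>, which tends to \<open>F'(0)\<close>.\<close>
  moreover have H0: "(H has_field_derivative - of_real A * deriv F 0) (at 0)"
  proof -
    have ev: "\<forall>\<^sub>F z in at 0. z \<in> ball 0 1 \<and> z \<noteq> (0::complex)"
      using eventually_at_ball'[of 1 0 UNIV] by (auto elim!: eventually_mono)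
    have F0lim: "(F \<longlongrightarrow> 0) (at 0)"
      using DERIV_isCont[OF dF[of 0]] F0 by (simp add: isCont_def)
    have "filterlim F (at 0) (at 0)"
      unfolding filterlim_at using F0lim ev Fnz by (auto elim!: eventually_mono)
    then have "filterlim (\<lambda>z. inverse (F z)) at_infinity (at 0)"
      by (rule filterlim_compose[OF filterlim_inverse_at_infinity])
    from filterlim_compose[OF area_Cauchy_transform_at_infinity[OF K] this]
    have "((\<lambda>z. inverse (F z) * h (inverse (F z))) \<longlongrightarrow> - of_real A) (at 0)"
      by (simp add: h_def A_def)
    moreover have "((\<lambda>z. F z / z) \<longlongrightarrow> deriv F 0) (at 0)"
      using dF[of 0] F0 by (simp add: has_field_derivative_iff)
    ultimately have "((\<lambda>z. (inverse (F z) * h (inverse (F z))) * (F z / z)) \<longlongrightarrow> - of_real A * deriv F 0) (at 0)"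
      by (rule tendsto_mult)
    then have "((\<lambda>z. (H z - H 0) / (z - 0)) \<longlongrightarrow> - of_real A * deriv F 0) (at 0)"
    proof (rule Lim_transform_eventually)
      show "\<forall>\<^sub>F z in at 0. (inverse (F z) * h (inverse (F z))) * (F z / z) = (H z - H 0) / (z - 0)"
        using ev by eventually_elim (use Fnz in \<open>auto simp: H_def field_simps\<close>)
    qed
    then show ?thesis by (simp add: has_field_derivative_iff)
  qed
  ultimately have "\<exists>D. (H has_field_derivative D) (at z)" if "z \<in> ball 0 1" for z
    using that by (cases "z = 0") auto
  then have holH: "H holomorphic_on ball 0 1"
    by (simp add: holomorphic_on_open)
  have "cmod (H z) \<le> sqrt (pi * A)" if "z \<in> ball 0 1" for z
    using Fnz[OF that] Ahlfors_Beurling[OF K, of "1 / F z"] A0 by (auto simp: H_def h_def A_def)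
  \<comment> \<open>Cauchy's inequality turns the bound \<open>sqrt (pi * A)\<close> for
    \<open>H\<close> into one for \<open>A * cmod (deriv F 0)\<close>; squaring and cancelling a
    factor \<open>A\<close> gives the claim.\<close>
  from norm_deriv_0_le[OF holH this] have "A * cmod (deriv F 0) \<le> sqrt (pi * A)"
    using DERIV_imp_deriv[OF H0] A0 by (simp add: norm_mult)
  then have "(A * cmod (deriv F 0))\<^sup>2 \<le> (sqrt (pi * A))\<^sup>2"
    using A0 by (intro power_mono) auto
  then have "A * (A * (cmod (deriv F 0))\<^sup>2) \<le> A * pi"
    using A0 by (simp add: power_mult_distrib power2_eq_square mult_ac)
  then show ?thesis
    using A0 by (cases "A = 0") (simp_all add: A_def[symmetric] mult_le_cancel_left_pos)
qed

text \<open>The area is the integral of \<open>(cmod (deriv k z))\<^sup>2\<close>. With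
  \<open>c = deriv k 0\<close>, expanding \<open>(cmod (deriv k z - c))\<^sup>2 \<ge> 0\<close>
  bounds the integrand below by the real part of a holomorphic function whose mean value is
  \<open>(cmod c)\<^sup>2\<close>.\<close>

lemma area_injective_image_ge:
  assumes k: "k holomorphic_on ball 0 R" and inj: "inj_on k (ball 0 R)" and \<rho>: "0 \<le> \<rho>" "\<rho> < R"
  shows "pi * \<rho>\<^sup>2 * (cmod (deriv k 0))\<^sup>2 \<le> measure lborel (k ` cball 0 \<rho>)"
proof -
  let ?K = "cball (0::complex) \<rho>"
  have sub: "?K \<subseteq> ball 0 R" using \<rho> by auto
  have dk: "deriv k holomorphic_on ball 0 R"
    using k by (rule holomorphic_deriv) auto
  have cdk: "continuous_on ?K (deriv k)"
    using dk sub by (meson continuous_on_subset holomorphic_on_imp_continuous_on)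
  have der: "(k has_field_derivative deriv k z) (at z within ?K)" if "z \<in> ?K" for z
    using that sub by (intro has_field_derivative_at_within[OF holomorphic_derivI[OF k]]) auto
  have kK: "compact (k ` ?K)"
    using continuous_on_subset[OF holomorphic_on_imp_continuous_on[OF k] sub] by (rule compact_continuous_image) simp
  define c where "c = deriv k 0"
  have "complex_of_real (measure lborel (k ` ?K)) = (LINT z:?K|lborel. (cmod (deriv k z))\<^sup>2 *\<^sub>R 1)"
    unfolding of_real_measure_compact[OF kK]
    by (rule set_integral_injective_image) (use der inj_on_subset[OF inj sub] cdk in auto)
  also have "\<dots> = of_real (LINT z:?K|lborel. (cmod (deriv k z))\<^sup>2)"
    unfolding set_lebesgue_integral_def integral_complex_of_real[symmetric]
    by (rule Bochner_Integration.integral_cong) (simp_all add: scaleR_conv_of_real)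
  finally have "measure lborel (k ` ?K) = (LINT z:?K|lborel. (cmod (deriv k z))\<^sup>2)"
    by (simp only: of_real_eq_iff)
  also have "\<dots> \<ge> (LINT z:?K|lborel. Re (2 * cnj c * deriv k z - of_real ((cmod c)\<^sup>2)))"
  proof (rule set_integral_mono[OF set_integrable_compact set_integrable_compact])
    show "continuous_on ?K (\<lambda>z. Re (2 * cnj c * deriv k z - of_real ((cmod c)\<^sup>2)))"
         "continuous_on ?K (\<lambda>z. (cmod (deriv k z))\<^sup>2)"
      using cdk by (auto intro!: continuous_intros)
    fix z
    have "0 \<le> (cmod (deriv k z - c))\<^sup>2" by simp
    then show "Re (2 * cnj c * deriv k z - of_real ((cmod c)\<^sup>2)) \<le> (cmod (deriv k z))\<^sup>2"
      unfolding cmod_power2 by (simp add: power2_eq_square algebra_simps)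
  qed auto
  moreover have "(LINT z:?K|lborel. Re (2 * cnj c * deriv k z - of_real ((cmod c)\<^sup>2))) = pi * \<rho>\<^sup>2 * (cmod c)\<^sup>2"
  proof -
    have cont: "continuous_on ?K (\<lambda>z. 2 * cnj c * deriv k z - of_real ((cmod c)\<^sup>2))"
      using cdk by (auto intro!: continuous_intros)
    have "(LINT z:?K|lborel. Re (2 * cnj c * deriv k z - of_real ((cmod c)\<^sup>2))) =
        Re (LINT z:?K|lborel. 2 * cnj c * deriv k z - of_real ((cmod c)\<^sup>2))"
      using set_integrable_compact[OF compact_cball cont]
      unfolding set_lebesgue_integral_def set_integrable_def by (simp flip: integral_Re)
    also have "(LINT z:?K|lborel. 2 * cnj c * deriv k z - of_real ((cmod c)\<^sup>2)) =
        (pi * \<rho>\<^sup>2) *\<^sub>R (2 * cnj c * deriv k 0 - of_real ((cmod c)\<^sup>2))"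
      by (rule area_mean_value[OF _ \<rho>])
         (intro holomorphic_on_diff holomorphic_on_mult holomorphic_on_const dk)
    also have "2 * cnj c * deriv k 0 - of_real ((cmod c)\<^sup>2) = of_real ((cmod c)\<^sup>2)"
      by (simp add: c_def complex_norm_square[symmetric] mult_ac flip: complex_norm_square)
    finally show ?thesis by simp
  qed
  ultimately show ?thesis by (simp add: c_def)
qed

section \<open>Koebe's estimate for nonvanishing univalent functions\<close>

text \<open>A square root \<open>G\<close> of \<open>\<phi>\<close> and \<open>- G\<close> have disjoint images. The image of \<open>G\<close> under
  \<open>w \<mapsto> 1 / (w + G 0)\<close> has area at least \<open>\<pi> \<rho>\<^sup>2 |G'(0)|\<^sup>2 / |2 G(0)|\<^sup>4\<close>, while it is omitted by the reciprocal of
  \<open>G 0 - G\<close> and so has area at most \<open>\<pi> / |G'(0)|\<^sup>2\<close>.\<close>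

lemma Koebe_nonvanishing:
  assumes \<phi>: "\<phi> holomorphic_on ball 0 1" and inj: "inj_on \<phi> (ball 0 1)"
    and nz: "\<And>z. z \<in> ball 0 1 \<Longrightarrow> \<phi> z \<noteq> 0"
  shows "cmod (deriv \<phi> 0) \<le> 4 * cmod (\<phi> 0)"
proof -
  obtain G where G: "G holomorphic_on ball 0 1" and G2: "\<And>z. z \<in> ball 0 1 \<Longrightarrow> \<phi> z = (G z)\<^sup>2"
    using contractible_imp_holomorphic_sqrt[OF \<phi> convex_imp_contractible[OF convex_ball]] nz
    by auto
  have Gnz: "G z \<noteq> 0" if "z \<in> ball 0 1" for z
    using G2[OF that] nz[OF that] by auto
  have Ginj: "z = y" if "z \<in> ball 0 1" "y \<in> ball 0 1" "(G z)\<^sup>2 = (G y)\<^sup>2" for z y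
    using inj that G2 by (metis inj_onD)
  have sumnz: "G z + G y \<noteq> 0" if "z \<in> ball 0 1" "y \<in> ball 0 1" for z y
  proof
    assume *: "G z + G y = 0"
    then have "G z = - G y" by (simp add: add_eq_0_iff2)
    then have "z = y" using Ginj that by simp
    then show False using * Gnz that by simp
  qed
  define k where "k z = 1 / (G z + G 0)" for z
  have k: "k holomorphic_on ball 0 1"
    unfolding k_def using sumnz by (intro holomorphic_intros G) auto
  have kinj: "inj_on k (ball 0 1)"
    using Ginj sumnz by (intro inj_onI) (auto simp: k_def divide_simps)
  have dG: "(G has_field_derivative deriv G 0) (at 0)"
    by (rule holomorphic_derivI[OF G open_ball]) simp
  have "(k has_field_derivative - deriv G 0 / (2 * G 0)\<^sup>2) (at 0)"
    unfolding k_def using Gnz[of 0]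
    by (auto intro!: derivative_eq_intros dG simp: power2_eq_square)
  from DERIV_imp_deriv[OF this] have dk: "cmod (deriv k 0) = cmod (deriv G 0) / (4 * (cmod (G 0))\<^sup>2)"
    by (simp add: norm_divide norm_mult norm_power power_mult_distrib)
  define F where "F z = G 0 - G z" for z
  have dF: "deriv F 0 = - deriv G 0"
    unfolding F_def by (rule DERIV_imp_deriv) (auto intro!: derivative_eq_intros dG)
  have bound: "\<rho>\<^sup>2 * (cmod (deriv k 0))\<^sup>2 * (cmod (deriv G 0))\<^sup>2 \<le> 1" if \<rho>: "0 < \<rho>" "\<rho> < 1" for \<rho>
  proof -
    let ?K = "k ` cball 0 \<rho>"
    have sub: "cball 0 \<rho> \<subseteq> ball (0::complex) 1" using \<rho> by auto
    have "compact ?K"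
      using continuous_on_subset[OF holomorphic_on_imp_continuous_on[OF k] sub]
      by (rule compact_continuous_image) simp
    moreover have "F holomorphic_on ball 0 1"
      unfolding F_def by (intro holomorphic_intros G)
    \<comment> \<open>A common value of \<open>1 / F\<close> and \<open>k\<close> would give
      \<open>G x = - G z\<close>, excluded by \<open>sumnz\<close>.\<close>
    moreover have "F z \<noteq> 0 \<and> 1 / F z \<notin> ?K" if z: "z \<in> ball 0 1" "z \<noteq> 0" for z
    proof
      show Fz: "F z \<noteq> 0" using Ginj[of z 0] z by (auto simp: F_def)
      show "1 / F z \<notin> ?K"
      proof
        assume "1 / F z \<in> ?K"
        then obtain x where x: "x \<in> ball 0 1" "1 / F z = k x" using sub by blast
        then have "G x + G 0 = G 0 - G z"
          using Fz sumnz[of x 0] by (simp add: k_def F_def divide_simps)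
        then have "G x + G z = 0" by (simp add: add_eq_0_iff2)
        then show False using sumnz x z by auto
      qed
    qed
    ultimately have "measure lborel ?K * (cmod (deriv F 0))\<^sup>2 \<le> pi"
      by (intro area_omitted_by_reciprocal_le) (auto simp: F_def)
    moreover have "pi * \<rho>\<^sup>2 * (cmod (deriv k 0))\<^sup>2 \<le> measure lborel ?K"
      using \<rho> by (intro area_injective_image_ge[OF k kinj]) auto
    ultimately have "pi * \<rho>\<^sup>2 * (cmod (deriv k 0))\<^sup>2 * (cmod (deriv G 0))\<^sup>2 \<le> pi"
      unfolding dF norm_minus_cancel by (meson mult_right_mono order_trans zero_le_power2)
    then have "pi * (\<rho>\<^sup>2 * (cmod (deriv k 0))\<^sup>2 * (cmod (deriv G 0))\<^sup>2) \<le> pi * 1"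
      by (simp add: mult_ac)
    then show ?thesis by (simp only: mult_le_cancel_left_pos pi_gt_zero)
  qed
  have "((\<lambda>\<rho>. \<rho>\<^sup>2 * (cmod (deriv k 0))\<^sup>2 * (cmod (deriv G 0))\<^sup>2) \<longlongrightarrow> 1\<^sup>2 * (cmod (deriv k 0))\<^sup>2 * (cmod (deriv G 0))\<^sup>2) (at_left (1::real))"
    by (intro tendsto_intros)
  moreover have "\<forall>\<^sub>F \<rho> in at_left 1. \<rho>\<^sup>2 * (cmod (deriv k 0))\<^sup>2 * (cmod (deriv G 0))\<^sup>2 \<le> 1"
    using eventually_at_left_real[of 0 1] by (auto elim!: eventually_mono intro: bound)
  ultimately have "1\<^sup>2 * (cmod (deriv k 0))\<^sup>2 * (cmod (deriv G 0))\<^sup>2 \<le> 1"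
    by (rule tendsto_upperbound) simp
  then have "(cmod (deriv k 0) * cmod (deriv G 0))\<^sup>2 \<le> 1\<^sup>2"
    by (simp add: power_mult_distrib)
  then have "cmod (deriv k 0) * cmod (deriv G 0) \<le> 1"
    by (rule power2_le_imp_le) simp
  \<comment> \<open>By \<open>dk\<close> the product on the left is
    \<open>(cmod (deriv G 0))\<^sup>2 / (2 * cmod (G 0))\<^sup>2\<close>. The constant 4 then comes
    from \<open>\<phi>' = 2 * G * G'\<close>.\<close>
  then have "(cmod (deriv G 0))\<^sup>2 \<le> (2 * cmod (G 0))\<^sup>2"
    using Gnz[of 0] by (simp add: dk power2_eq_square field_simps)
  then have "cmod (deriv G 0) \<le> 2 * cmod (G 0)"
    by (rule power2_le_imp_le) simp
  moreover have "deriv \<phi> 0 = 2 * G 0 * deriv G 0"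
  proof (rule DERIV_imp_deriv)
    have "((\<lambda>z. (G z)\<^sup>2) has_field_derivative 2 * G 0 * deriv G 0) (at 0)"
      by (auto intro!: derivative_eq_intros dG)
    then show "(\<phi> has_field_derivative 2 * G 0 * deriv G 0) (at 0)"
      by (rule has_field_derivative_transform_within_open[of _ _ _ "ball 0 1"]) (auto simp: G2)
  qed
  ultimately show ?thesis
    using G2[of 0] mult_left_mono[of "cmod (deriv G 0)" "2 * cmod (G 0)" "2 * cmod (G 0)"]
    by (simp add: norm_mult norm_power power2_eq_square)
qed

section \<open>Moving the base point by disc automorphisms\<close>

lemma Moebius_0_has_derivative:
  assumes "norm c < 1"
  shows "(Moebius_function 0 (- c) has_field_derivative of_real (1 - (cmod c)\<^sup>2)) (at 0)"
proof -
  have "((\<lambda>z. (z - (- c)) / (1 - cnj (- c) * z)) has_field_derivative of_real (1 - (cmod c)\<^sup>2)) (at 0)"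
    by (auto intro!: derivative_eq_intros simp flip: complex_norm_square)
  then show ?thesis
    by (simp add: Moebius_function_simple[abs_def])
qed

lemma deriv_compose:
  assumes "f holomorphic_on S" "g holomorphic_on T" "open S" "open T" "z \<in> S" "f z \<in> T"
    "\<And>x. x \<in> S \<Longrightarrow> h x = g (f x)"
  shows "deriv h z = deriv g (f z) * deriv f z"
proof (rule DERIV_imp_deriv)
  have "((\<lambda>x. g (f x)) has_field_derivative deriv g (f z) * deriv f z) (at z)"
    using assms by (intro DERIV_chain2[OF holomorphic_derivI holomorphic_derivI]) auto
  then show "(h has_field_derivative deriv g (f z) * deriv f z) (at z)"
    by (rule has_field_derivative_transform_within_open[of _ _ _ S]) (use assms in auto)
qed

lemma Moebius_maps_disc: "norm c < 1 \<Longrightarrow> z \<in> ball 0 1 \<Longrightarrow> Moebius_function 0 c z \<in> ball 0 1"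
  using Moebius_function_norm_lt_1[of c z 0] by simp

text \<open>An automorphism inserted between \<phi> and \<open>w\<close> gives
  \<open>h = \<psi> \<circ> v\<close> with \<open>v 0 = 0\<close>. Koebe's bound applies to the
  univalent nonvanishing \<psi>, and Cauchy's inequality bounds \<open>v'(0)\<close> by 1. The value
  \<open>w 0\<close> is arbitrary so that \<open>w\<close> may later be composed with an
  automorphism.\<close>

lemma Koebe_nonvanishing_subordinate_0:
  assumes \<phi>: "\<phi> holomorphic_on ball 0 1" and inj: "inj_on \<phi> (ball 0 1)"
    and nz: "\<And>z. z \<in> ball 0 1 \<Longrightarrow> \<phi> z \<noteq> 0"
    and w: "w holomorphic_on ball 0 1" "\<And>z. z \<in> ball 0 1 \<Longrightarrow> w z \<in> ball 0 1"
    and h: "\<And>z. z \<in> ball 0 1 \<Longrightarrow> h z = \<phi> (w z)"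
  shows "cmod (deriv h 0) \<le> 4 * cmod (h 0)"
proof -
  define c where "c = w 0"
  have c: "norm c < 1" "norm (- c) < 1" using w(2)[of 0] by (auto simp: c_def)
  let ?M = "Moebius_function 0 (- c)" and ?N = "Moebius_function 0 c"
  define \<psi> where "\<psi> u = \<phi> (?M u)" for u
  define v where "v z = ?N (w z)" for z
  have M: "?M holomorphic_on ball 0 1" "?N holomorphic_on ball 0 1"
    using c by (auto intro: Moebius_function_holomorphic)
  note Mb = Moebius_maps_disc[OF c(1)] Moebius_maps_disc[OF c(2)]
  have "\<phi> \<circ> ?M holomorphic_on ball 0 1"
    using Mb by (intro holomorphic_on_compose_gen[OF M(1) \<phi>]) auto
  then have \<psi>: "\<psi> holomorphic_on ball 0 1" by (simp add: \<psi>_def[abs_def] o_def)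
  have "?N \<circ> w holomorphic_on ball 0 1"
    using w(2) by (intro holomorphic_on_compose_gen[OF w(1) M(2)]) auto
  then have v: "v holomorphic_on ball 0 1" by (simp add: v_def[abs_def] o_def)
  have vb: "v z \<in> ball 0 1" if "z \<in> ball 0 1" for z
    unfolding v_def by (intro Mb w that)
  have NM: "?N (?M u) = u" "?M (?N u) = u" if "u \<in> ball 0 1" for u
    using that c by (auto intro!: Moebius_function_compose)
  have "inj_on \<psi> (ball 0 1)"
  proof (rule inj_onI)
    fix x y assume xy: "x \<in> ball 0 1" "y \<in> ball 0 1" "\<psi> x = \<psi> y"
    then have "?M x = ?M y" using inj Mb unfolding \<psi>_def by (meson inj_onD)
    then show "x = y" using NM(1) xy by metis
  qed
  then have 1: "cmod (deriv \<psi> 0) \<le> 4 * cmod (\<psi> 0)"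
    using Mb nz by (intro Koebe_nonvanishing \<psi>) (auto simp: \<psi>_def)
  have 2: "cmod (deriv v 0) \<le> 1"
    using vb by (intro norm_deriv_0_le v) (auto simp: less_imp_le)
  have v0: "v 0 = 0" by (simp add: v_def c_def Moebius_function_eq_zero)
  have hv: "h z = \<psi> (v z)" if "z \<in> ball 0 1" for z
    using that w(2) by (simp add: h \<psi>_def v_def NM)
  have "deriv h 0 = deriv \<psi> (v 0) * deriv v 0"
    by (rule deriv_compose[OF v \<psi>]) (use hv v0 in auto)
  then have "cmod (deriv h 0) = cmod (deriv \<psi> 0) * cmod (deriv v 0)"
    by (simp add: v0 norm_mult)
  also have "\<dots> \<le> 4 * cmod (\<psi> 0) * 1"
    by (intro mult_mono 1 2) auto
  also have "\<psi> 0 = h 0" using hv[of 0] v0 by simp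
  finally show ?thesis by simp
qed

text \<open>The case of the origin is applied to \<open>h\<close> composed with the automorphism
  taking 0 to \<open>z\<close>, whose derivative at 0 is
  \<open>1 - (cmod z)\<^sup>2\<close>.\<close>

lemma Koebe_nonvanishing_subordinate:
  assumes \<phi>: "\<phi> holomorphic_on ball 0 1" and inj: "inj_on \<phi> (ball 0 1)"
    and nz: "\<And>z. z \<in> ball 0 1 \<Longrightarrow> \<phi> z \<noteq> 0"
    and w: "w holomorphic_on ball 0 1" "\<And>z. z \<in> ball 0 1 \<Longrightarrow> w z \<in> ball 0 1"
    and h: "\<And>z. z \<in> ball 0 1 \<Longrightarrow> h z = \<phi> (w z)" and hol: "h holomorphic_on ball 0 1"
    and z: "z \<in> ball 0 1"
  shows "cmod (deriv h z) * (1 - (cmod z)\<^sup>2) \<le> 4 * cmod (h z)"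
proof -
  let ?M = "Moebius_function 0 (- z)"
  have z1: "norm z < 1" "norm (- z) < 1" using z by auto
  have M: "?M holomorphic_on ball 0 1" using z1 by (intro Moebius_function_holomorphic)
  note Mb = Moebius_maps_disc[OF z1(2)]
  have M0: "?M 0 = z" by (simp add: Moebius_function_of_zero)
  have "w \<circ> ?M holomorphic_on ball 0 1"
    using Mb by (intro holomorphic_on_compose_gen[OF M w(1)]) auto
  then have wM: "(\<lambda>u. w (?M u)) holomorphic_on ball 0 1" by (simp add: o_def)
  have "cmod (deriv (\<lambda>u. h (?M u)) 0) \<le> 4 * cmod (h (?M 0))"
    by (rule Koebe_nonvanishing_subordinate_0[OF \<phi> inj nz wM]) (use w h Mb in auto)
  also have "deriv (\<lambda>u. h (?M u)) 0 = deriv h (?M 0) * deriv ?M 0"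
    by (rule deriv_compose[OF M hol]) (use M0 z in auto)
  also have "deriv ?M 0 = of_real (1 - (cmod z)\<^sup>2)"
    by (rule DERIV_imp_deriv[OF Moebius_0_has_derivative[OF z1(1)]])
  finally show ?thesis
    using z1 by (simp only: M0 norm_mult norm_of_real) (simp add: abs_square_le_1)
qed

section \<open>Coefficient estimates and majorants\<close>

definition taylor_coeff :: "(complex \<Rightarrow> complex) \<Rightarrow> nat \<Rightarrow> complex" where
  "taylor_coeff f n = (deriv ^^ n) f 0 / fact n"

lemma taylor_coeff_0 [simp]: "taylor_coeff f 0 = f 0"
  by (simp add: taylor_coeff_def)

lemma taylor_coeff_deriv: "taylor_coeff (deriv f) n = of_nat (Suc n) * taylor_coeff f (Suc n)"
  unfolding taylor_coeff_def funpow_Suc_right o_apply fact_Suc by (simp del: of_nat_Suc)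

lemma taylor_coeff_mult:
  assumes "f holomorphic_on ball 0 1" "g holomorphic_on ball 0 1"
    and "\<And>z. z \<in> ball 0 1 \<Longrightarrow> p z = f z * g z"
  shows "taylor_coeff p n = (\<Sum>k\<le>n. taylor_coeff f k * taylor_coeff g (n - k))"
proof -
  have f: "f has_fps_expansion fps_expansion f 0" and g: "g has_fps_expansion fps_expansion g 0"
    using assms by (auto intro!: has_fps_expansion_fps_expansion[of "ball 0 1"])
  have "\<forall>\<^sub>F z in nhds 0. z \<in> ball (0::complex) 1"
    by (rule eventually_nhds_in_open) auto
  then have "\<forall>\<^sub>F z in nhds 0. f z * g z = p z"
    by eventually_elim (simp add: assms(3))
  then have "p has_fps_expansion fps_expansion f 0 * fps_expansion g 0"
    using has_fps_expansion_mult[OF f g] by (subst (asm) has_fps_expansion_cong) auto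
  from fps_nth_fps_expansion[OF this, of n] show ?thesis
    by (simp add: taylor_coeff_def fps_mult_nth fps_expansion_def atLeast0AtMost)
qed

lemma taylor_coeff_sums:
  assumes "\<And>z. z \<in> ball 0 1 \<Longrightarrow> (\<lambda>n. a n * z ^ n) sums f z"
  shows "taylor_coeff f n = a n"
proof -
  have "\<forall>\<^sub>F z in nhds 0. z \<in> ball (0::complex) 1"
    by (rule eventually_nhds_in_open) auto
  then have "f has_fps_expansion Abs_fps a"
    by (intro has_fps_expansionI) (auto elim!: eventually_mono intro: assms)
  from fps_nth_fps_expansion[OF this, of n] show ?thesis
    by (simp add: taylor_coeff_def)
qed

text \<open>Cauchy's formula for the \<open>n\<close>-th derivative; the velocity of the circle is
  \<open>2 * pi * \<i>\<close> times its position, which cancels one power and the constant.\<close>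

lemma circlepath_mean_value:
  assumes contf: "continuous_on (cball 0 \<rho>) f" and holf: "f holomorphic_on ball 0 \<rho>" and \<rho>: "0 < \<rho>"
  shows "((\<lambda>t. f (circlepath 0 \<rho> t) / circlepath 0 \<rho> t ^ n) has_integral taylor_coeff f n) {0..1}"
proof -
  let ?g = "circlepath 0 \<rho>"
  have "((\<lambda>u. f u / (u - 0) ^ Suc n) has_contour_integral (2 * pi * \<i>) / fact n * (deriv ^^ n) f 0) ?g"
    using \<rho> by (intro Cauchy_has_contour_integral_higher_derivative_circlepath contf holf) auto
  then have "((\<lambda>t. f (?g t) / ?g t ^ Suc n * vector_derivative ?g (at t within {0..1})) has_integral
      (2 * pi * \<i>) / fact n * (deriv ^^ n) f 0) {0..1}"
    by (simp add: has_contour_integral_def)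
  then have "((\<lambda>t. (2 * pi * \<i>) * (f (?g t) / ?g t ^ n)) has_integral
      (2 * pi * \<i>) * taylor_coeff f n) {0..1}"
  proof (rule has_integral_eq_rhs[OF has_integral_eq, rotated])
    fix t :: real assume t: "t \<in> {0..1}"
    have "?g t = of_real \<rho> * exp (2 * of_real pi * \<i> * of_real t)"
      by (simp add: circlepath)
    moreover from this have "?g t \<noteq> 0" using \<rho> by simp
    ultimately show "f (?g t) / ?g t ^ Suc n * vector_derivative ?g (at t within {0..1}) = (2 * pi * \<i>) * (f (?g t) / ?g t ^ n)"
      using t by (simp add: vector_derivative_circlepath01)
  qed (simp add: taylor_coeff_def)
  then have "((\<lambda>t. 1 / (2 * pi * \<i>) * ((2 * pi * \<i>) * (f (?g t) / ?g t ^ n))) has_integral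
      1 / (2 * pi * \<i>) * ((2 * pi * \<i>) * taylor_coeff f n)) {0..1}"
    by (rule has_integral_mult_right)
  then show ?thesis by simp
qed

text \<open>Integrating \<open>f\<close> against the nonnegative kernel \<open>2 + 2 Re (l u\<^sup>n / \<rho>\<^sup>n)\<close> of mass 2 produces
  \<open>2 c\<^sub>0 + cnj l \<rho>\<^sup>n c\<^sub>n\<close>; the unimodular \<open>l\<close> is chosen to align the two terms.\<close>

lemma taylor_coeff_bound:
  assumes f: "f holomorphic_on ball 0 1" and \<rho>: "0 < \<rho>" "\<rho> < 1" and n: "n \<noteq> 0"
    and M: "\<And>z. cmod z = \<rho> \<Longrightarrow> cmod (f z) \<le> M"
  shows "cmod (taylor_coeff f n) * \<rho> ^ n \<le> 2 * (M - cmod (f 0))"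
proof -
  let ?g = "circlepath 0 \<rho>"
  define l where "l = cis (Arg (taylor_coeff f n) - Arg (f 0))"
  define \<kappa> where "\<kappa> t = 2 + 2 * Re (l * ?g t ^ n / of_real \<rho> ^ n)" for t
  have g\<rho>: "cmod (?g t) = \<rho>" for t
    using \<rho> by (simp add: circlepath norm_mult)
  have l1: "cmod l = 1" by (simp add: l_def)
  have \<kappa>_nonneg: "0 \<le> \<kappa> t" for t
  proof -
    have "\<bar>Re (l * ?g t ^ n / of_real \<rho> ^ n)\<bar> \<le> cmod (l * ?g t ^ n / of_real \<rho> ^ n)"
      by (rule abs_Re_le_cmod)
    also have "\<dots> = 1"
      using \<rho> g\<rho> l1 by (simp add: norm_mult norm_divide norm_power)
    finally show ?thesis unfolding \<kappa>_def by linarith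
  qed
  \<comment> \<open>On the circle the conjugate of \<open>u\<close> is
    \<open>\<rho>\<^sup>2 / u\<close>, so the kernel is a combination of powers of \<open>u\<close>,
    each of which \<open>circlepath_mean_value\<close> can integrate.\<close>
  have \<kappa>_eq: "of_real (\<kappa> t) = 2 + l * ?g t ^ n / of_real \<rho> ^ n + cnj l * of_real \<rho> ^ n / ?g t ^ n" for t
  proof -
    have "cnj (?g t) = of_real (\<rho>\<^sup>2) / ?g t"
      using complex_norm_square[of "?g t"] g\<rho>[of t] \<rho> by (auto simp: field_simps)
    then have "cnj (l * ?g t ^ n / of_real \<rho> ^ n) = cnj l * of_real \<rho> ^ n / ?g t ^ n"
      using \<rho> by (simp add: power_divide power2_eq_square power_mult_distrib)
    then have "l * ?g t ^ n / of_real \<rho> ^ n + cnj l * of_real \<rho> ^ n / ?g t ^ n = of_real (2 * Re (l * ?g t ^ n / of_real \<rho> ^ n))"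
      using complex_add_cnj[of "l * ?g t ^ n / of_real \<rho> ^ n"] by simp
    then show ?thesis by (simp add: \<kappa>_def)
  qed
  have kernel: "((\<lambda>t. F (?g t) * of_real (\<kappa> t)) has_integral (2 * F 0 + cnj l * of_real \<rho> ^ n * taylor_coeff F n)) {0..1}"
    if F: "F holomorphic_on ball 0 1" for F
  proof -
    have c: "continuous_on (cball 0 \<rho>) F" "F holomorphic_on ball 0 \<rho>"
      using \<rho> by (auto intro!: holomorphic_on_subset[OF F] continuous_on_subset[OF holomorphic_on_imp_continuous_on[OF F]])
    have c': "continuous_on (cball 0 \<rho>) (\<lambda>u. F u * u ^ n)" "(\<lambda>u. F u * u ^ n) holomorphic_on ball 0 \<rho>"
      using c by (auto intro!: continuous_intros holomorphic_intros)
    have 1: "((\<lambda>t. F (?g t)) has_integral F 0) {0..1}"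
      using circlepath_mean_value[OF c \<rho>(1), of 0] by simp
    \<comment> \<open>As \<open>n \<noteq> 0\<close>, the function \<open>F u * u ^ n\<close>
      vanishes at the centre, and so does its mean.\<close>
    have 2: "((\<lambda>t. F (?g t) * ?g t ^ n) has_integral 0) {0..1}"
      using circlepath_mean_value[OF c' \<rho>(1), of 0] n by (simp add: power_0_left)
    have 3: "((\<lambda>t. F (?g t) / ?g t ^ n) has_integral taylor_coeff F n) {0..1}"
      by (rule circlepath_mean_value[OF c \<rho>(1)])
    have "((\<lambda>t. 2 * F (?g t) + l / of_real \<rho> ^ n * (F (?g t) * ?g t ^ n) + cnj l * of_real \<rho> ^ n * (F (?g t) / ?g t ^ n))
       has_integral (2 * F 0 + l / of_real \<rho> ^ n * 0 + cnj l * of_real \<rho> ^ n * taylor_coeff F n)) {0..1}"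
      by (intro has_integral_add has_integral_mult_right 1 2 3)
    then show ?thesis
      unfolding \<kappa>_eq by (simp add: algebra_simps)
  qed
  \<comment> \<open>The constant function 1 yields the mass of the kernel.\<close>
  have "((\<lambda>t. 1 * of_real (\<kappa> t)) has_integral (2 * 1 + cnj l * of_real \<rho> ^ n * taylor_coeff (\<lambda>_. 1) n)) {0..1}"
    by (rule kernel) auto
  then have "((\<lambda>t. complex_of_real (\<kappa> t)) has_integral of_real 2) {0..1}"
    using n by (simp add: taylor_coeff_def higher_deriv_const)
  from has_integral_Re[OF this] have \<kappa>2: "(\<kappa> has_integral 2) {0..1}"
    by simp
  note int = kernel[OF f]
  have "cmod (integral {0..1} (\<lambda>t. f (?g t) * of_real (\<kappa> t))) \<le> integral {0..1} (\<lambda>t. M * \<kappa> t)"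
  proof (rule integral_norm_bound_integral)
    show "(\<lambda>t. f (?g t) * of_real (\<kappa> t)) integrable_on {0..1}" using int by blast
    show "(\<lambda>t. M * \<kappa> t) integrable_on {0..1}" using has_integral_mult_right[OF \<kappa>2] by blast
    show "cmod (f (?g t) * of_real (\<kappa> t)) \<le> M * \<kappa> t" for t
      using \<kappa>_nonneg[of t] M[OF g\<rho>] by (simp add: norm_mult mult_right_mono)
  qed
  also have "\<dots> = M * 2"
    by (rule integral_unique[OF has_integral_mult_right[OF \<kappa>2]])
  finally have *: "cmod (2 * f 0 + cnj l * of_real \<rho> ^ n * taylor_coeff f n) \<le> 2 * M"
    using integral_unique[OF int] by simp
  have polar: "z = of_real (cmod z) * cis (Arg z)" for z
    using rcis_cmod_Arg[of z] by (simp add: rcis_def)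
  have "cnj l * taylor_coeff f n = of_real (cmod (taylor_coeff f n)) * cis (Arg (f 0))"
    by (subst polar[of "taylor_coeff f n"]) (simp add: l_def cis_cnj cis_mult)
  then have "2 * f 0 + cnj l * of_real \<rho> ^ n * taylor_coeff f n
     = 2 * f 0 + of_real (\<rho> ^ n * cmod (taylor_coeff f n)) * cis (Arg (f 0))"
    by (simp add: mult_ac)
  also have "\<dots> = of_real (2 * cmod (f 0) + \<rho> ^ n * cmod (taylor_coeff f n)) * cis (Arg (f 0))"
    by (subst (1) polar[of "f 0"]) (simp add: algebra_simps)
  finally have "cmod (2 * f 0 + cnj l * of_real \<rho> ^ n * taylor_coeff f n) = 2 * cmod (f 0) + \<rho> ^ n * cmod (taylor_coeff f n)"
    using \<rho> by (simp only: norm_mult norm_cis norm_of_real) simp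
  with * show ?thesis by (simp add: mult_ac)
qed

section \<open>Differential inequalities for partial sums of majorant series\<close>

lemma sum_Cauchy_product_le:
  fixes a b u :: "nat \<Rightarrow> real"
  assumes a: "\<And>n. 0 \<le> a n" and b: "\<And>n. 0 \<le> b n"
    and u: "\<And>n. u n \<le> (\<Sum>k\<le>n. a k * b (n - k))" and x: "0 \<le> x"
  shows "(\<Sum>n<N. u n * x ^ n) \<le> (\<Sum>n<N. a n * x ^ n) * (\<Sum>n<N. b n * x ^ n)"
proof -
  let ?f = "\<lambda>i j. (a i * x ^ i) * (b j * x ^ j)"
  have "(\<Sum>n<N. u n * x ^ n) \<le> (\<Sum>n<N. \<Sum>k\<le>n. ?f k (n - k))"
  proof (rule sum_mono)
    fix n
    have "u n * x ^ n \<le> (\<Sum>k\<le>n. a k * b (n - k)) * x ^ n"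
      using u x by (intro mult_right_mono) auto
    also have "\<dots> = (\<Sum>k\<le>n. ?f k (n - k))"
      unfolding sum_distrib_right by (intro sum.cong refl) (simp add: mult_ac flip: power_add)
    finally show "u n * x ^ n \<le> (\<Sum>k\<le>n. ?f k (n - k))" .
  qed
  also have "\<dots> = (\<Sum>(i,j)\<in>{(i,j). i + j < N}. ?f i j)"
    by (rule sum.triangle_reindex[symmetric])
  \<comment> \<open>The triangle \<open>i + j < N\<close> lies in the square, and all terms are
    nonnegative.\<close>
  also have "\<dots> \<le> (\<Sum>(i,j)\<in>{..<N} \<times> {..<N}. ?f i j)"
    using a b x by (intro sum_mono2) (auto intro!: mult_nonneg_nonneg)
  also have "\<dots> = (\<Sum>n<N. a n * x ^ n) * (\<Sum>n<N. b n * x ^ n)"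
    by (simp add: sum_product sum.cartesian_product)
  finally show ?thesis .
qed

lemma partial_sum_has_derivative:
  fixes e :: "nat \<Rightarrow> real"
  shows "((\<lambda>x. \<Sum>n<N. e (Suc n) * x ^ Suc n) has_field_derivative
           (\<Sum>n<N. real (Suc n) * e (Suc n) * x ^ n)) (at x)"
  by (rule derivative_eq_intros refl | simp add: mult_ac del: of_nat_Suc power_Suc)+

text \<open>Gronwall's inequality, since the derivative of each partial sum is at most \<open>\<Sum> c\<^sub>k x\<^sup>k\<close> times the sum.\<close>

lemma exp_majorant:
  fixes e c :: "nat \<Rightarrow> real"
  assumes e: "\<And>n. 0 \<le> e n" and c: "\<And>n. 0 \<le> c n"
    and rec: "\<And>n. real (Suc n) * e (Suc n) \<le> (\<Sum>k\<le>n. c k * e (n - k))" and r: "0 \<le> r"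
  shows "e 0 + (\<Sum>n<N. e (Suc n) * r ^ Suc n) \<le> e 0 * exp (\<Sum>k<N. c k / real (Suc k) * r ^ Suc k)"
proof -
  define E where "E x = e 0 + (\<Sum>n<N. e (Suc n) * x ^ Suc n)" for x
  define P where "P x = (\<Sum>k<N. c k / real (Suc k) * x ^ Suc k)" for x
  have dE: "(E has_field_derivative (\<Sum>n<N. real (Suc n) * e (Suc n) * x ^ n)) (at x)" for x
    unfolding E_def by (rule derivative_eq_intros partial_sum_has_derivative refl | simp)+
  \<comment> \<open>The sequence in \<open>partial_sum_has_derivative\<close> is read only at
    successors, where \<open>k - 1\<close> undoes the shift.\<close>
  have dP: "(P has_field_derivative (\<Sum>k<N. c k * x ^ k)) (at x)" for x
    using partial_sum_has_derivative[of "\<lambda>k. c (k - 1) / real k" N x] by (simp add: P_def[abs_def] del: of_nat_Suc power_Suc)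
  have "E r * exp (- P r) \<le> E 0 * exp (- P 0)"
  proof (rule DERIV_nonpos_imp_nonincreasing[OF r])
    fix x :: real assume x: "0 \<le> x" "x \<le> r"
    let ?S = "\<Sum>n<N. e n * x ^ n"
    have "(\<Sum>n<N. real (Suc n) * e (Suc n) * x ^ n) \<le> (\<Sum>k<N. c k * x ^ k) * ?S"
      by (rule sum_Cauchy_product_le[OF c e rec x(1)])
    \<comment> \<open>\<open>E x\<close> runs up to index \<open>N\<close>, one nonnegative term
      further than \<open>?S\<close>.\<close>
    also have "?S \<le> E x"
    proof -
      have "?S \<le> (\<Sum>n<Suc N. e n * x ^ n)"
        using e x by simp
      also have "\<dots> = E x"
        unfolding sum.lessThan_Suc_shift E_def by simp
      finally show ?thesis .
    qed
    finally have le: "(\<Sum>n<N. real (Suc n) * e (Suc n) * x ^ n) \<le> (\<Sum>k<N. c k * x ^ k) * E x"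
      using c x by (simp add: mult_left_mono sum_nonneg)
    have "((\<lambda>x. E x * exp (- P x)) has_field_derivative
        ((\<Sum>n<N. real (Suc n) * e (Suc n) * x ^ n) - (\<Sum>k<N. c k * x ^ k) * E x) * exp (- P x)) (at x)"
      by (rule derivative_eq_intros dE dP refl | simp add: algebra_simps)+
    moreover have "((\<Sum>n<N. real (Suc n) * e (Suc n) * x ^ n) - (\<Sum>k<N. c k * x ^ k) * E x) * exp (- P x) \<le> 0"
      using le by (intro mult_nonpos_nonneg) auto
    ultimately show "\<exists>y. ((\<lambda>x. E x * exp (- P x)) has_field_derivative y) (at x) \<and> y \<le> 0"
      by blast
  qed
  then have "E r * exp (- P r) * exp (P r) \<le> e 0 * exp (P r)"
    by (simp add: E_def P_def)
  then show ?thesis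
    by (simp add: mult.assoc flip: exp_add) (simp add: E_def P_def)
qed

text \<open>Both sides vanish at 0. On \<open>[0, r]\<close> the derivative of the
  \<open>b\<close>-sum is at most the derivative of the \<open>a\<close>-sum times the partial sum
  of \<open>c k * x ^ k\<close>, which is at most 1.\<close>

lemma partial_sum_le_of_multiplier:
  fixes a b c :: "nat \<Rightarrow> real"
  assumes a: "\<And>n. 0 \<le> a n" and c: "\<And>n. 0 \<le> c n"
    and rec: "\<And>n. real (Suc n) * b (Suc n) \<le> (\<Sum>k\<le>n. c k * (real (Suc (n - k)) * a (Suc (n - k))))"
    and r: "0 \<le> r" and C: "(\<Sum>k<N. c k * r ^ k) \<le> 1"
  shows "(\<Sum>n<N. b (Suc n) * r ^ Suc n) \<le> (\<Sum>n<N. a (Suc n) * r ^ Suc n)"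
proof -
  define D where "D x = (\<Sum>n<N. a (Suc n) * x ^ Suc n) - (\<Sum>n<N. b (Suc n) * x ^ Suc n)" for x
  have "D 0 \<le> D r"
  proof (rule DERIV_nonneg_imp_nondecreasing[OF r])
    fix x :: real assume x: "0 \<le> x" "x \<le> r"
    let ?A = "\<Sum>n<N. real (Suc n) * a (Suc n) * x ^ n" and ?B = "\<Sum>n<N. real (Suc n) * b (Suc n) * x ^ n"
    have A0: "0 \<le> ?A" using a x by (intro sum_nonneg mult_nonneg_nonneg) auto
    have "?B \<le> (\<Sum>k<N. c k * x ^ k) * ?A"
      by (rule sum_Cauchy_product_le[OF c _ _ x(1)]) (use a rec in auto)
    also have "\<dots> \<le> 1 * ?A"
    proof (rule mult_right_mono[OF _ A0])
      have "(\<Sum>k<N. c k * x ^ k) \<le> (\<Sum>k<N. c k * r ^ k)"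
        using c x by (intro sum_mono mult_left_mono power_mono) auto
      then show "(\<Sum>k<N. c k * x ^ k) \<le> 1" using C by simp
    qed
    finally have "0 \<le> ?A - ?B" by simp
    moreover have "(D has_field_derivative ?A - ?B) (at x)"
      unfolding D_def by (intro DERIV_diff partial_sum_has_derivative)
    ultimately show "\<exists>y. (D has_field_derivative y) (at x) \<and> 0 \<le> y" by blast
  qed
  then show ?thesis by (simp add: D_def)
qed

section \<open>Bohr sums at the radius 0.0991\<close>

text \<open>The value 3/2 is chosen so that \<open>exp\<close> of the exponent minus 1 is at most
  1/2, the share of the distance allotted to \<open>h\<close>.\<close>

lemma ln_three_halves_ge: "0.4052 \<le> ln (3 / 2 :: real)"
  using ln_approx_bounds[of "3/2" 2] by (simp add: eval_nat_numeral)

lemma sum_tail_geometric_le: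
  fixes c :: "nat \<Rightarrow> real"
  assumes c: "\<And>k. 2 \<le> k \<Longrightarrow> c k \<le> B * q ^ k" and q: "0 \<le> q" "q < 1" and B: "0 \<le> B"
  shows "(\<Sum>k\<in>{2..<N}. c k) \<le> B * (q\<^sup>2 / (1 - q))"
proof -
  have "(\<Sum>k\<in>{2..<N}. c k) \<le> (\<Sum>k\<in>{2..<N}. B * q ^ k)"
    by (intro sum_mono c) auto
  also have "\<dots> = B * (\<Sum>k\<in>{2..<N}. q ^ k)"
    by (simp add: sum_distrib_left)
  also have "(\<Sum>k\<in>{2..<N}. q ^ k) \<le> q\<^sup>2 / (1 - q)"
  proof (cases "2 \<le> N")
    case True
    have "(1 - q) * (\<Sum>k\<in>{2..<N}. q ^ k) = q ^ 2 - q ^ N"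
      using True
    proof (induction N rule: dec_induct)
      case (step n)
      have "(1 - q) * q ^ n = q ^ n - q ^ Suc n"
        by (simp add: left_diff_distrib)
      then show ?case
        using step by (simp add: distrib_left del: power_Suc)
    qed simp
    then have "(1 - q) * (\<Sum>k\<in>{2..<N}. q ^ k) \<le> q\<^sup>2"
      using q by simp
    then show ?thesis using q by (simp add: pos_le_divide_eq mult.commute)
  qed (use q in auto)
  then have "B * (\<Sum>k\<in>{2..<N}. q ^ k) \<le> B * (q\<^sup>2 / (1 - q))"
    using B by (rule mult_left_mono)
  finally show ?thesis .
qed

text \<open>Terms 0 and 1 are kept apart and the rest is dominated by a geometric series. The
  resulting bound is affine and increasing in \<open>c 0\<close>, so the worst case is
  \<open>c 0 = 4\<close>, with value about 0.4051.\<close>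

lemma exponent_le:
  fixes c :: "nat \<Rightarrow> real"
  assumes c: "\<And>k. 0 \<le> c k"
    and bound: "\<And>\<rho> k. 0 < \<rho> \<Longrightarrow> \<rho> < 1 \<Longrightarrow> k \<noteq> 0 \<Longrightarrow> c k * \<rho> ^ k \<le> 2 * (4 / (1 - \<rho>\<^sup>2) - c 0)"
    and c0: "c 0 \<le> 4"
  shows "(\<Sum>k<N. c k / real (Suc k) * 0.0991 ^ Suc k) \<le> 0.4052"
proof -
  let ?t = "\<lambda>k. c k / real (Suc k) * 0.0991 ^ Suc k"
  \<comment> \<open>At \<open>c 0 = 4\<close> the right side of \<open>bound\<close> is of order
    \<open>\<rho>\<^sup>2\<close>, so a small \<rho> gives a small bound for \<open>c 1\<close>;
    0.11 is still large enough for the total to increase with \<open>c 0\<close>.\<close>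
  have c1: "c 1 \<le> 2 * (4 / (1 - 0.11\<^sup>2) - c 0) / 0.11"
    using bound[of "0.11" 1] by (simp add: field_simps)
  \<comment> \<open>Here \<rho> is 1/2, whence \<open>16 / 3 = 4 / (1 - 1 / 4)\<close> and the ratio
    \<open>0.1982 = 2 * 0.0991\<close>; the divisor 3 bounds \<open>Suc k\<close> from
    below.\<close>
  have tail: "?t k \<le> (2 * (16 / 3 - c 0) * 0.0991 / 3) * 0.1982 ^ k" if "2 \<le> k" for k
  proof -
    have "c k * (1 / 2) ^ k \<le> 2 * (16 / 3 - c 0)"
      using bound[of "1/2" k] that by (simp add: power2_eq_square)
    then have "c k \<le> 2 * (16 / 3 - c 0) * 2 ^ k"
      by (simp add: power_divide field_simps)
    moreover have "?t k \<le> c k / 3 * 0.0991 ^ Suc k"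
      using c that by (intro mult_right_mono divide_left_mono) auto
    ultimately have "?t k \<le> 2 * (16 / 3 - c 0) * 2 ^ k / 3 * 0.0991 ^ Suc k"
      by (meson divide_right_mono mult_right_mono order_trans zero_le_numeral zero_le_power zero_le_divide_iff)
    also have "\<dots> = (2 * (16 / 3 - c 0) * 0.0991 / 3) * (2 * 0.0991) ^ k"
      unfolding power_mult_distrib by simp
    finally show ?thesis by simp
  qed
  \<comment> \<open>Passing to \<open>N + 2\<close> ensures that the terms 0 and 1 can be split off
    for every \<open>N\<close>.\<close>
  have "(\<Sum>k<N. ?t k) \<le> (\<Sum>k<N + 2. ?t k)"
    using c by (intro sum_mono2) auto
  also have "\<dots> = (\<Sum>k\<in>{0..<2}. ?t k) + (\<Sum>k\<in>{2..<N + 2}. ?t k)"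
    unfolding lessThan_atLeast0 by (rule sum.atLeastLessThan_concat[symmetric]) auto
  also have "(\<Sum>k\<in>{2..<N + 2}. ?t k) \<le> (2 * (16 / 3 - c 0) * 0.0991 / 3) * (0.1982\<^sup>2 / (1 - 0.1982))"
    using c0 by (intro sum_tail_geometric_le tail) auto
  also have "(\<Sum>k\<in>{0..<2}. ?t k) = c 0 * 0.0991 + c 1 / 2 * 0.0991\<^sup>2"
    by (simp add: numeral_2_eq_2 power2_eq_square)
  also have "\<dots> + (2 * (16 / 3 - c 0) * 0.0991 / 3) * (0.1982\<^sup>2 / (1 - 0.1982)) \<le> 0.4052"
    using c0 c1 by (simp add: power2_eq_square field_simps)
  finally show ?thesis by simp
qed

text \<open>Comparing coefficients in \<open>h' = F * h\<close> gives the recursion of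
  \<open>exp_majorant\<close>, and Koebe's estimate controls the coefficients of \<open>F\<close>
  through \<open>taylor_coeff_bound\<close>.\<close>

lemma Bohr_sum_nonvanishing_subordinate:
  assumes \<phi>: "\<phi> holomorphic_on ball 0 1" "inj_on \<phi> (ball 0 1)"
      "\<And>z. z \<in> ball 0 1 \<Longrightarrow> \<phi> z \<noteq> 0"
    and w: "w holomorphic_on ball 0 1" "\<And>z. z \<in> ball 0 1 \<Longrightarrow> w z \<in> ball 0 1"
    and h: "\<And>z. z \<in> ball 0 1 \<Longrightarrow> h z = \<phi> (w z)" and hol: "h holomorphic_on ball 0 1"
  shows "(\<Sum>n<N. cmod (taylor_coeff h (Suc n)) * 0.0991 ^ Suc n) \<le> cmod (h 0) / 2"
proof -
  have hnz: "h z \<noteq> 0" if "z \<in> ball 0 1" for z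
    using that h w \<phi>(3) by metis
  have dh: "deriv h holomorphic_on ball 0 1"
    using hol by (rule holomorphic_deriv) auto
  define F where "F z = deriv h z / h z" for z
  have F: "F holomorphic_on ball 0 1"
    unfolding F_def using hnz by (rule holomorphic_on_divide[OF dh hol])
  have FM: "cmod (F z) \<le> 4 / (1 - (cmod z)\<^sup>2)" if "z \<in> ball 0 1" for z
  proof -
    have "(cmod z)\<^sup>2 < 1" using that by (simp add: abs_square_less_1)
    then show ?thesis
      using Koebe_nonvanishing_subordinate[OF \<phi> w h hol that] hnz[OF that]
      by (simp add: F_def norm_divide field_simps)
  qed
  define c e where "c n = cmod (taylor_coeff F n)" and "e n = cmod (taylor_coeff h n)" for n
  have rec: "real (Suc n) * e (Suc n) \<le> (\<Sum>k\<le>n. c k * e (n - k))" for n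
  proof -
    have "of_nat (Suc n) * taylor_coeff h (Suc n) = (\<Sum>k\<le>n. taylor_coeff F k * taylor_coeff h (n - k))"
      unfolding taylor_coeff_deriv[symmetric]
      by (rule taylor_coeff_mult[OF F hol]) (use hnz in \<open>auto simp: F_def\<close>)
    then have "real (Suc n) * e (Suc n) = cmod (\<Sum>k\<le>n. taylor_coeff F k * taylor_coeff h (n - k))"
      unfolding e_def by (metis norm_mult norm_of_nat)
    also have "\<dots> \<le> (\<Sum>k\<le>n. c k * e (n - k))"
      by (rule order_trans[OF norm_sum]) (simp add: c_def e_def norm_mult)
    finally show ?thesis .
  qed
  have "e 0 + (\<Sum>n<N. e (Suc n) * 0.0991 ^ Suc n) \<le> e 0 * exp (\<Sum>k<N. c k / real (Suc k) * 0.0991 ^ Suc k)"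
    by (rule exp_majorant[OF _ _ rec]) (auto simp: c_def e_def)
  also have "exp (\<Sum>k<N. c k / real (Suc k) * 0.0991 ^ Suc k) \<le> exp (ln (3 / 2))"
  proof -
    have "(\<Sum>k<N. c k / real (Suc k) * 0.0991 ^ Suc k) \<le> 0.4052"
    proof (rule exponent_le)
      show "0 \<le> c k" for k by (simp add: c_def)
      show "c 0 \<le> 4" using FM[of 0] by (simp add: c_def)
      show "c k * \<rho> ^ k \<le> 2 * (4 / (1 - \<rho>\<^sup>2) - c 0)" if "0 < \<rho>" "\<rho> < 1" "k \<noteq> 0" for \<rho> k
        using taylor_coeff_bound[OF F that, of "4 / (1 - \<rho>\<^sup>2)"] FM that by (auto simp: c_def)
    qed
    also note ln_three_halves_ge
    finally show ?thesis by (simp only: exp_le_cancel_iff)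
  qed
  then have "e 0 * exp (\<Sum>k<N. c k / real (Suc k) * 0.0991 ^ Suc k) \<le> e 0 * (3 / 2)"
    by (intro mult_left_mono) (auto simp: e_def)
  finally show ?thesis by (simp add: e_def)
qed

text \<open>The multiplier \<omega> is bounded by 1. By \<open>taylor_coeff_bound\<close> with
  \<rho> equal to 1/2, its terms from index 1 on add up to less than \<open>(1 - c 0) / 2\<close> at
  0.0991, so the whole sum stays below 1.\<close>

lemma Bohr_sum_le_of_deriv_le:
  assumes h: "h holomorphic_on ball 0 1" and g: "g holomorphic_on ball 0 1"
    and lt: "\<And>z. z \<in> ball 0 1 \<Longrightarrow> cmod (deriv g z) < cmod (deriv h z)"
  shows "(\<Sum>n<N. cmod (taylor_coeff g (Suc n)) * 0.0991 ^ Suc n)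
       \<le> (\<Sum>n<N. cmod (taylor_coeff h (Suc n)) * 0.0991 ^ Suc n)"
proof -
  define \<omega> where "\<omega> z = deriv g z / deriv h z" for z
  have nz: "deriv h z \<noteq> 0" if "z \<in> ball 0 1" for z
    using lt[OF that] by auto
  have dh: "deriv h holomorphic_on ball 0 1" and dg: "deriv g holomorphic_on ball 0 1"
    using h g by (auto intro: holomorphic_deriv)
  have \<omega>: "\<omega> holomorphic_on ball 0 1"
    unfolding \<omega>_def using nz by (rule holomorphic_on_divide[OF dg dh])
  have \<omega>1: "cmod (\<omega> z) \<le> 1" if "z \<in> ball 0 1" for z
    using lt[OF that] nz[OF that] by (simp add: \<omega>_def norm_divide)
  define c where "c n = cmod (taylor_coeff \<omega> n)" for n
  have c_bound: "c k * 0.0991 ^ k \<le> 2 * (1 - c 0) * 0.1982 ^ k" if "k \<noteq> 0" for k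
  proof -
    have "c k * (1 / 2) ^ k \<le> 2 * (1 - c 0)"
      unfolding c_def taylor_coeff_0 using that \<omega>1 by (intro taylor_coeff_bound[OF \<omega>]) auto
    then have "c k * (1 / 2) ^ k * 0.1982 ^ k \<le> 2 * (1 - c 0) * 0.1982 ^ k"
      by (rule mult_right_mono) simp
    then show ?thesis by (simp add: mult.assoc flip: power_mult_distrib)
  qed
  have c0: "0 \<le> 1 - c 0" using \<omega>1[of 0] by (simp add: c_def)
  show ?thesis
  proof (rule partial_sum_le_of_multiplier)
    show "(\<Sum>k<N. c k * 0.0991 ^ k) \<le> 1"
    proof -
      have "(\<Sum>k<N. c k * 0.0991 ^ k) \<le> (\<Sum>k<N + 2. c k * 0.0991 ^ k)"
        by (intro sum_mono2) (auto simp: c_def)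
      also have "\<dots> = (\<Sum>k\<in>{0..<2}. c k * 0.0991 ^ k) + (\<Sum>k\<in>{2..<N + 2}. c k * 0.0991 ^ k)"
        unfolding lessThan_atLeast0 by (rule sum.atLeastLessThan_concat[symmetric]) auto
      also have "(\<Sum>k\<in>{2..<N + 2}. c k * 0.0991 ^ k) \<le> 2 * (1 - c 0) * (0.1982\<^sup>2 / (1 - 0.1982))"
        using c0 c_bound by (intro sum_tail_geometric_le) auto
      also have "(\<Sum>k\<in>{0..<2}. c k * 0.0991 ^ k) = c 0 + c 1 * 0.0991"
        by (simp add: numeral_2_eq_2)
      also have "c 0 + c 1 * 0.0991 + 2 * (1 - c 0) * (0.1982\<^sup>2 / (1 - 0.1982)) \<le> 1"
        using c0 c_bound[of 1] by (simp add: power2_eq_square field_simps)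
      finally show ?thesis by simp
    qed
    show "real (Suc n) * cmod (taylor_coeff g (Suc n))
       \<le> (\<Sum>k\<le>n. c k * (real (Suc (n - k)) * cmod (taylor_coeff h (Suc (n - k)))))" for n
    proof -
      have "of_nat (Suc n) * taylor_coeff g (Suc n) =
          (\<Sum>k\<le>n. taylor_coeff \<omega> k * (of_nat (Suc (n - k)) * taylor_coeff h (Suc (n - k))))"
        unfolding taylor_coeff_deriv[symmetric]
        by (rule taylor_coeff_mult[OF \<omega> dh]) (use nz in \<open>auto simp: \<omega>_def\<close>)
      then have "real (Suc n) * cmod (taylor_coeff g (Suc n)) =
          cmod (\<Sum>k\<le>n. taylor_coeff \<omega> k * (of_nat (Suc (n - k)) * taylor_coeff h (Suc (n - k))))"
        by (metis norm_mult norm_of_nat)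
      also have "\<dots> \<le> (\<Sum>k\<le>n. c k * (real (Suc (n - k)) * cmod (taylor_coeff h (Suc (n - k)))))"
        by (rule order_trans[OF norm_sum]) (simp add: c_def norm_mult del: of_nat_Suc)
      finally show ?thesis .
    qed
  qed (auto simp: c_def)
qed

text \<open>Otherwise the image is the whole plane, and the inverse is a bounded entire function,
  contradicting Liouville's theorem. This secures a nearest boundary point, as
  \<open>infdist\<close> to the empty set is 0 by convention.\<close>

lemma univalent_image_frontier_nonempty:
  assumes \<phi>: "\<phi> holomorphic_on ball 0 1" and inj: "inj_on \<phi> (ball 0 1)"
  shows "frontier (\<phi> ` ball 0 1) \<noteq> {}"
proof
  assume "frontier (\<phi> ` ball 0 1) = {}"
  then have U: "\<phi> ` ball 0 1 = UNIV"
    unfolding frontier_eq_empty by auto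
  obtain \<psi> where \<psi>: "\<psi> holomorphic_on \<phi> ` ball 0 1"
      "\<And>z. z \<in> ball 0 1 \<Longrightarrow> deriv \<phi> z * deriv \<psi> (\<phi> z) = 1" "\<And>z. z \<in> ball 0 1 \<Longrightarrow> \<psi> (\<phi> z) = z"
    using holomorphic_has_inverse[OF \<phi> open_ball inj] by metis
  have "range \<psi> \<subseteq> ball 0 1"
    using \<psi>(3) U by (metis (no_types, lifting) image_iff image_subsetI UNIV_I)
  then have "bounded (range \<psi>)"
    using bounded_ball bounded_subset by blast
  then obtain k where k: "\<And>z. \<psi> z = k"
    using Liouville_theorem[of \<psi>] \<psi>(1) unfolding U constant_on_def by auto
  have "\<psi> (\<phi> 0) = 0" "\<psi> (\<phi> (1/2)) = 1/2"
    by (rule \<psi>(3); simp)+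
  then show False using k by simp
qed

section \<open>The equation defining \<open>r_u\<close>\<close>

lemma radius_function_strict_antimono:
  assumes "0 < r" "r < s" "s < 1"
  shows "(1 - s)\<^sup>2 - 4 * s * (1 + sqrt (1 + s)) < (1 - r)\<^sup>2 - 4 * r * (1 + sqrt (1 + r :: real))"
proof -
  have "(1 - s)\<^sup>2 < (1 - r)\<^sup>2"
    using assms by (intro power_strict_mono) auto
  moreover have "4 * r * (1 + sqrt (1 + r)) < 4 * s * (1 + sqrt (1 + s))"
    by (rule mult_strict_mono) (use assms in \<open>auto intro: add_nonneg_nonneg\<close>)
  ultimately show ?thesis by simp
qed

text \<open>A sign change between the two decimals gives a root, and strict monotonicity makes it
  unique. Rational bounds for the square roots decide the signs.\<close>

lemma radius_root_ex1_bounds: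
  shows "\<exists>!r. radius_root r" and "0.099064 \<le> r_u" and "r_u < 0.099065"
proof -
  define p :: "real \<Rightarrow> real" where "p r = (1 - r)\<^sup>2 - 4 * r * (1 + sqrt (1 + r))" for r
  have lo: "0 \<le> p 0.099064"
  proof -
    have "sqrt (1 + 0.099064) \<le> 1.048363"
      by (rule real_le_lsqrt) (auto simp: power2_eq_square)
    then show ?thesis by (simp add: p_def power2_eq_square)
  qed
  have hi: "p 0.099065 < 0"
  proof -
    have "1.0483629 \<le> sqrt (1 + 0.099065)"
      by (rule real_le_rsqrt) (auto simp: power2_eq_square)
    then show ?thesis by (simp add: p_def power2_eq_square)
  qed
  have "\<exists>r\<ge>0.099064. r \<le> 0.099065 \<and> p r = 0"
    using lo hi unfolding p_def by (intro IVT2') (auto intro!: continuous_intros)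
  then obtain r where r: "0.099064 \<le> r" "r \<le> 0.099065" "p r = 0" by blast
  have root: "radius_root r" using r by (simp add: radius_root_def p_def)
  have uniq: "s = r" if "radius_root s" for s
    using radius_function_strict_antimono[of r s] radius_function_strict_antimono[of s r] that root
    unfolding radius_root_def by (cases s r rule: linorder_cases) auto
  show "\<exists>!r. radius_root r" using root uniq by blast
  have "r_u = r" unfolding r_u_def using root uniq by (rule the_equality)
  moreover have "r \<noteq> 0.099065" using r(3) hi by (metis less_irrefl)
  ultimately show "0.099064 \<le> r_u" "r_u < 0.099065" using r by auto
qed

section \<open>The Bohr inequality for sense-preserving harmonic mappings\<close>

theorem corollary4:
  fixes f h g \<phi> :: "complex \<Rightarrow> complex" and a b :: "nat \<Rightarrow> complex"
  assumes "sense_preserving_harmonic f h g"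
    and "\<And>z. z \<in> ball 0 1 \<Longrightarrow> (\<lambda>n. a n * z ^ n) sums h z"
    and "\<And>z. z \<in> ball 0 1 \<Longrightarrow> (\<lambda>n. b (Suc n) * z ^ Suc n) sums g z"
    and "\<phi> holomorphic_on ball 0 1" and "inj_on \<phi> (ball 0 1)"
    and "subordinate h \<phi>"
  shows "(\<exists>!r. radius_root r) \<and> 0.099064 \<le> r_u \<and> r_u < 0.099065 \<and>
    (\<forall>z r. cmod z = r \<and> r \<le> r_u \<longrightarrow>
       summable (\<lambda>n. (cmod (a (Suc n)) + cmod (b (Suc n))) * r ^ Suc n) \<and>
       (\<Sum>n. (cmod (a (Suc n)) + cmod (b (Suc n))) * r ^ Suc n)
         \<le> infdist (\<phi> 0) (frontier (\<phi> ` ball 0 1)))"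
proof -
  let ?R = "frontier (\<phi> ` ball 0 1)"
  define d where "d = infdist (\<phi> 0) ?R"
  have h: "h holomorphic_on ball 0 1" and g: "g holomorphic_on ball 0 1"
    using assms(1) by (auto simp: sense_preserving_harmonic_def canonical_decomposition_def)
  have lt: "cmod (deriv g z) < cmod (deriv h z)" if "z \<in> ball 0 1" for z
    using assms(1) that by (auto simp: sense_preserving_harmonic_def intro: power2_less_imp_less)
  obtain w where w: "w holomorphic_on ball 0 1"
      "\<And>z. z \<in> ball 0 1 \<Longrightarrow> cmod (w z) \<le> cmod z" "\<And>z. z \<in> ball 0 1 \<Longrightarrow> h z = \<phi> (w z)"
    and h0: "h 0 = \<phi> 0"
    using assms(6) by (auto simp: subordinate_def)
  have wb: "w z \<in> ball 0 1" if "z \<in> ball 0 1" for z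
    using w(2)[OF that] that by simp
  obtain w0 where w0: "w0 \<in> ?R" "d = dist (\<phi> 0) w0"
    using infdist_attains_inf[OF frontier_closed univalent_image_frontier_nonempty[OF assms(4,5)], of "\<phi> 0"]
    unfolding d_def by metis
  \<comment> \<open>An open image omits its frontier points, so \<open>\<phi> - w0\<close> has no
    zeros.\<close>
  have "open (\<phi> ` ball 0 1)"
    by (rule open_mapping_thm3[OF assms(4) open_ball assms(5)])
  then have w0': "w0 \<notin> \<phi> ` ball 0 1"
    using w0(1) by (simp add: frontier_def interior_open)
  \<comment> \<open>Subtracting \<open>w0\<close> changes only the constant coefficient.\<close>
  have a: "taylor_coeff (\<lambda>z. h z - w0) (Suc n) = a (Suc n)" "taylor_coeff h (Suc n) = a (Suc n)" for n
  proof -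
    have "taylor_coeff (\<lambda>z. h z - w0) (Suc n) = (if Suc n = 0 then a 0 - w0 else a (Suc n))"
    proof (rule taylor_coeff_sums)
      fix z :: complex assume z: "z \<in> ball 0 1"
      have "(\<lambda>n. a n * z ^ n - (if n = 0 then w0 else 0)) sums (h z - w0)"
        by (intro sums_diff assms(2) z sums_single)
      moreover have "(\<lambda>n. a n * z ^ n - (if n = 0 then w0 else 0)) = (\<lambda>n. (if n = 0 then a 0 - w0 else a n) * z ^ n)"
        by auto
      ultimately show "(\<lambda>n. (if n = 0 then a 0 - w0 else a n) * z ^ n) sums (h z - w0)" by simp
    qed
    then show "taylor_coeff (\<lambda>z. h z - w0) (Suc n) = a (Suc n)" by simp
    show "taylor_coeff h (Suc n) = a (Suc n)" by (rule taylor_coeff_sums[OF assms(2)])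
  qed
  have b: "taylor_coeff g (Suc n) = b (Suc n)" for n
  proof -
    \<comment> \<open>The hypothesis on \<open>g\<close> fixes \<open>b\<close> from index 1 on, so
      the value at index 0 is replaced by 0, the constant coefficient of \<open>g\<close>.\<close>
    have "taylor_coeff g (Suc n) = (if Suc n = 0 then 0 else b (Suc n))"
    proof (rule taylor_coeff_sums)
      fix z :: complex assume z: "z \<in> ball 0 1"
      have "(\<lambda>n. (if Suc n = 0 then 0 else b (Suc n)) * z ^ Suc n) sums (g z - (if (0::nat) = 0 then 0 else b 0) * z ^ 0)"
        using assms(3)[OF z] by simp
      then show "(\<lambda>n. (if n = 0 then 0 else b n) * z ^ n) sums g z"
        by (subst (asm) sums_Suc_iff) simp
    qed
    then show ?thesis by simp
  qed
  have A: "(\<Sum>n<N. cmod (a (Suc n)) * 0.0991 ^ Suc n) \<le> d / 2" for N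
  proof -
    have "(\<Sum>n<N. cmod (taylor_coeff (\<lambda>z. h z - w0) (Suc n)) * 0.0991 ^ Suc n) \<le> cmod (h 0 - w0) / 2"
    proof (rule Bohr_sum_nonvanishing_subordinate[where \<phi> = "\<lambda>z. \<phi> z - w0" and w = w])
      show "(\<lambda>z. \<phi> z - w0) holomorphic_on ball 0 1" "(\<lambda>z. h z - w0) holomorphic_on ball 0 1"
        by (intro holomorphic_intros assms(4) h)+
      show "inj_on (\<lambda>z. \<phi> z - w0) (ball 0 1)"
        using assms(5) by (auto simp: inj_on_def)
    qed (use w w0' wb in auto)
    then show ?thesis
      unfolding a by (simp add: w0(2) h0 dist_norm)
  qed
  have B: "(\<Sum>n<N. cmod (b (Suc n)) * 0.0991 ^ Suc n) \<le> d / 2" for N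
    using Bohr_sum_le_of_deriv_le[OF h g lt, of N] A[of N] unfolding a b by linarith
  have "summable (\<lambda>n. (cmod (a (Suc n)) + cmod (b (Suc n))) * r ^ Suc n) \<and>
       (\<Sum>n. (cmod (a (Suc n)) + cmod (b (Suc n))) * r ^ Suc n) \<le> d"
    if r: "0 \<le> r" "r \<le> r_u" for r
  proof -
    let ?s = "\<lambda>n. (cmod (a (Suc n)) + cmod (b (Suc n))) * r ^ Suc n"
    \<comment> \<open>Both halves were estimated at 0.0991, slightly beyond \<open>r_u\<close>; all
      terms increase with \<open>r\<close>.\<close>
    have r': "r \<le> 0.0991" using r(2) radius_root_ex1_bounds(3) by simp
    have le: "(\<Sum>n<N. ?s n) \<le> d" for N
    proof -
      have "(\<Sum>n<N. ?s n) \<le> (\<Sum>n<N. (cmod (a (Suc n)) + cmod (b (Suc n))) * 0.0991 ^ Suc n)"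
        using r r' by (intro sum_mono mult_left_mono power_mono) auto
      also have "\<dots> \<le> d"
        using A[of N] B[of N] unfolding distrib_right sum.distrib by linarith
      finally show ?thesis .
    qed
    have "summable ?s"
      by (rule summableI_nonneg_bounded[OF _ le]) (use r in auto)
    then show ?thesis using suminf_le_const le by blast
  qed
  then show ?thesis
    using radius_root_ex1_bounds by (auto simp: d_def)
qed

end
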